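(* The partial-dual genus polynomial, regarded as a function on chord diagrams, satisfies the four-term relation. Explicitly: let $n\ge 2$, let $D$ be a chord diagram with $n-1$ chords drawn on an oriented circle, let $s$ be a chord of $D$ with endpoints $b$ and $r$, and let $a$ be a point of the circle that is not an endpoint of any chord of $D$. For $p\in\{b,r\}$ let $p^-$ (respectively $p^+$) be a point of the circle immediately preceding (respectively immediately following) $p$ with respect to the orientation of the circle, so that neither $a$ nor any chord endpoint lies on the short arc between $p^{\pm}$ and $p$ other than $p$ itself. For $x\in\{b^-,b^+,r^-,r^+\}$ let $D_x$ be the chord diagram with $n$ chords obtained from $D$ by adding a chord with endpoints $a$ and $x$. Then $${}^\partial\Gamma_{D_{b^-}}(z)-{}^\partial\Gamma_{D_{b^+}}(z)+{}^\partial\Gamma_{D_{r^-}}(z)-{}^\partial\Gamma_{D_{r^+}}(z)=0$$ in $\mathbb{Z}[z]$, where ${}^\partial\Gamma_{D_x}(z):={}^\partial\Gamma_{G_{D_x}}(z)$ is the partial-dual genus polynomial of the one-vertex ribbon graph $G_{D_x}$ associated with $D_x$.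
   Context: **Chord diagrams.** A chord diagram of order $n$ is an oriented circle with a distinguished set of $n$ disjoint pairs of distinct points, considered up to orientation-preserving homeomorphisms of the circle. Each pair is called a chord, and its two points are the endpoints of the chord. **Ribbon graphs.** A ribbon graph $G$ is a surface with boundary decomposed into finitely many closed topological discs of two types, vertex-discs and edge-ribbons, such that: discs of the same type are pairwise disjoint; vertex-discs and edge-ribbons intersect in disjoint line segments; each such segment lies on the boundary of precisely one vertex-disc and precisely one edge-ribbon; and every edge-ribbon contains exactly two such segments, which are not adjacent. Thus an edge-ribbon is a rectangle attached to vertex-discs along two opposite sides. Ribbon graphs are considered up to homeomorphisms preserving the decomposition. $E(G)$ denotes the set of edge-ribbons. All ribbon graphs here are orientable. **Genus.** For a connected orientable ribbon graph $G$, the genus $g(G)$ is the genus of the closed surface obtained by gluing a disc to each boundary component of $G$. It is given by $2-2g(G)=v-e+f$, where $v$ is the number of vertex-discs, $e$ the number of edge-ribbons, and $f$ the number of boundary components of $G$. **Ribbon graph of a chord diagram.** For a chord diagram $D$, the ribbon graph $G_D$ has a single vertex-disc, bounded by the circle of $D$. Its edge-ribbons correspond to the chords of $D$: each chord is thickened to a narrow ribbon attached to the boundary of the vertex-disc along small arcs around the two endpoints of the chord, without twisting, so that the resulting surface is orientable. **Partial duality.** For a ribbon graph $G$ and $A\subseteq E(G)$, the partial dual $G^A$ of $G$ relative to $A$ is the following ribbon graph. Its vertex-discs are discs bounded by the connected components of the boundary of the spanning ribbon subgraph of $G$ consisting of all vertex-discs of $G$ and only the edge-ribbons in $A$. Its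 edge-ribbons are in one-to-one correspondence with those of $G$. The edge-ribbons in $E(G)\setminus A$ are attached to the new vertex-discs at exactly the same places as in $G$. For $e\in A$, the rectangle $e$ meets the vertex-discs of $G$ along one pair of opposite sides, and its other pair of opposite sides lies on the boundary of the spanning subgraph, that is, on the boundaries of the new vertex-discs. A copy $e'$ of $e$ is attached to the new vertex-discs along (the copies of) this second pair of sides, and the copies of the first pair of sides become arcs of the boundary of $G^A$. If $G$ is connected and orientable, so is $G^A$. **Partial-dual genus polynomial.** For a connected orientable ribbon graph $G$, $${}^\partial\Gamma_G(z):=\sum_{A\subseteq E(G)} z^{g(G^A)}\in\mathbb{Z}[z].$$ *)

theory Defs
  imports
    "HOL-Analysis.Complex_Transcendental"
    "HOL-Computational_Algebra.Polynomial"
begin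

section \<open>Ribbon graphs\<close>

text \<open>
  A ribbon graph up to homeomorphism is encoded by its flags, i.e. the corners of its
  edge-ribbons (four for each ribbon). The boundary of every edge-ribbon and of every vertex-disc
  is cut by these corners into intervals of three kinds, and each kind is recorded as the
  involution that exchanges the two ends of an interval:
  \<^item> \<open>attach\<close>: the segments along which ribbons are attached to vertex-discs;
  \<^item> \<open>free_side\<close>: the two other sides of every ribbon;
  \<^item> \<open>disc_arc\<close>: the arcs of the boundaries of vertex-discs between consecutive segments.

  A vertex-disc to which no ribbon is attached carries no flag; \<open>n_bare\<close> is the number of those.
\<close>

record 'f ribbon_graph =
  flags :: "'f set"
  free_side :: "'f \<Rightarrow> 'f"
  attach :: "'f \<Rightarrow> 'f"
  disc_arc :: "'f \<Rightarrow> 'f"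
  n_bare :: nat

definition fpf_involution_on :: "'f set \<Rightarrow> ('f \<Rightarrow> 'f) \<Rightarrow> bool" where
  "fpf_involution_on X h \<longleftrightarrow> (\<forall>x\<in>X. h x \<in> X \<and> h x \<noteq> x \<and> h (h x) = x)"

definition is_ribbon_graph :: "'f ribbon_graph \<Rightarrow> bool" where
  "is_ribbon_graph G \<longleftrightarrow>
     finite (flags G) \<and>
     fpf_involution_on (flags G) (free_side G) \<and>
     fpf_involution_on (flags G) (attach G) \<and>
     fpf_involution_on (flags G) (disc_arc G) \<and>
     (\<forall>f\<in>flags G. free_side G f \<noteq> attach G f \<and>
                   free_side G (attach G f) = attach G (free_side G f))"

definition orbits :: "'f set \<Rightarrow> ('f \<Rightarrow> 'f) set \<Rightarrow> 'f set set" where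
  "orbits X H = X // {(x, h x) | x h. x \<in> X \<and> h \<in> H}\<^sup>*"

text \<open>An edge-ribbon is identified with the set of its four corners.\<close>

definition edges :: "'f ribbon_graph \<Rightarrow> 'f set set" where
  "edges G = orbits (flags G) {free_side G, attach G}"

definition n_vertices :: "'f ribbon_graph \<Rightarrow> nat" where
  "n_vertices G = card (orbits (flags G) {attach G, disc_arc G}) + n_bare G"

definition n_boundary :: "'f ribbon_graph \<Rightarrow> nat" where
  "n_boundary G = card (orbits (flags G) {free_side G, disc_arc G}) + n_bare G"

definition connected_rg :: "'f ribbon_graph \<Rightarrow> bool" where
  "connected_rg G \<longleftrightarrow>
     card (orbits (flags G) {free_side G, attach G, disc_arc G}) + n_bare G = 1"

text \<open>
  Given orientations of the vertex-discs, \<open>c f\<close> says that \<open>f\<close> is the last rather than the first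
  point of its attaching segment. The orientations extend over the ribbons iff free sides always
  join a first point to a last point.
\<close>

definition orientable_rg :: "'f ribbon_graph \<Rightarrow> bool" where
  "orientable_rg G \<longleftrightarrow>
     (\<exists>c :: 'f \<Rightarrow> bool. \<forall>f\<in>flags G.
        c (free_side G f) \<noteq> c f \<and> c (attach G f) \<noteq> c f \<and> c (disc_arc G f) \<noteq> c f)"

text \<open>Meaningful for connected orientable ribbon graphs only.\<close>

definition genus :: "'f ribbon_graph \<Rightarrow> nat" where
  "genus G = (THE g. 2 - 2 * int g =
     int (n_vertices G) - int (card (edges G)) + int (n_boundary G))"

text \<open>
  The boundary of the spanning subgraph with edge set \<open>A\<close> runs along the free sides of the ribbons
  in \<open>A\<close>, along the attaching segments of the other ribbons (which stay attached there), and
  along the arcs of the old vertex-discs. The ribbons in \<open>A\<close> are attached to the new vertex-discs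
  along their former free sides, and their former attaching segments become free.
\<close>

definition partial_dual :: "'f ribbon_graph \<Rightarrow> 'f set set \<Rightarrow> 'f ribbon_graph" where
  "partial_dual G A = G\<lparr>
     free_side := (\<lambda>f. if f \<in> \<Union>A then attach G f else free_side G f),
     attach := (\<lambda>f. if f \<in> \<Union>A then free_side G f else attach G f)\<rparr>"

definition pd_genus_poly :: "'f ribbon_graph \<Rightarrow> int poly" where
  "pd_genus_poly G = (\<Sum>A\<in>Pow (edges G). monom 1 (genus (partial_dual G A)))"


section \<open>Chord diagrams\<close>

text \<open>Chord diagrams are drawn on the counterclockwise oriented unit circle.\<close>

abbreviation circle :: "complex set" where
  "circle \<equiv> sphere 0 1"

definition chord_diagram :: "nat \<Rightarrow> complex set set \<Rightarrow> bool" where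
  "chord_diagram n D \<longleftrightarrow>
     finite D \<and> card D = n \<and> disjoint D \<and> (\<forall>c\<in>D. c \<subseteq> circle \<and> card c = 2)"

text \<open>The open arc that leads counterclockwise from \<open>p\<close> to \<open>q\<close>, for distinct \<open>p\<close> and \<open>q\<close>.\<close>

definition ccw_arc :: "complex \<Rightarrow> complex \<Rightarrow> complex set" where
  "ccw_arc p q = {z \<in> circle. 0 < Arg2pi (z / p) \<and> Arg2pi (z / p) < Arg2pi (q / p)}"

definition next_pt :: "complex set \<Rightarrow> complex \<Rightarrow> complex" where
  "next_pt P p = (THE q. q \<in> P - {p} \<and> ccw_arc p q \<inter> P = {})"

definition prev_pt :: "complex set \<Rightarrow> complex \<Rightarrow> complex" where
  "prev_pt P p = (THE q. q \<in> P - {p} \<and> ccw_arc q p \<inter> P = {})"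

definition other_end :: "complex set set \<Rightarrow> complex \<Rightarrow> complex" where
  "other_end D p = (THE q. {p, q} \<in> D)"

text \<open>
  The ribbon of a chord is attached along a small arc around each endpoint \<open>p\<close>, whose first and
  last point in the counterclockwise direction are the flags \<open>(p, False)\<close> and \<open>(p, True)\<close>.
  Since ribbons are not twisted, a free side joins the first point of one of
  these arcs to the last point of the other.
\<close>

definition ribbon_graph_of :: "complex set set \<Rightarrow> (complex \<times> bool) ribbon_graph" where
  "ribbon_graph_of D = \<lparr>
     flags = \<Union>D \<times> UNIV,
     free_side = (\<lambda>(p, d). (other_end D p, \<not> d)),
     attach = (\<lambda>(p, d). (p, \<not> d)),
     disc_arc = (\<lambda>(p, d). if d then (next_pt (\<Union>D) p, False) else (prev_pt (\<Union>D) p, True)),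
     n_bare = (if D = {} then 1 else 0)\<rparr>"

definition chord_pd_genus_poly :: "complex set set \<Rightarrow> int poly" where
  "chord_pd_genus_poly D = pd_genus_poly (ribbon_graph_of D)"

text \<open>
  \<open>immediately_before P p x\<close> says that the half-open short arc from \<open>x\<close> to \<open>p\<close>, without \<open>p\<close>,
  contains no point of \<open>P\<close>.
\<close>

definition immediately_before :: "complex set \<Rightarrow> complex \<Rightarrow> complex \<Rightarrow> bool" where
  "immediately_before P p x \<longleftrightarrow> x \<in> circle \<and> x \<noteq> p \<and> x \<notin> P \<and> ccw_arc x p \<inter> P = {}"

definition immediately_after :: "complex set \<Rightarrow> complex \<Rightarrow> complex \<Rightarrow> bool" where
  "immediately_after P p x \<longleftrightarrow> x \<in> circle \<and> x \<noteq> p \<and> x \<notin> P \<and> ccw_arc p x \<inter> P = {}"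


section \<open>Consistency of the definitions\<close>

subsection \<open>Partial duals are ribbon graphs\<close>

lemma orbits_partial_dual:
  "orbits (flags G) (insert (free_side (partial_dual G A)) (insert (attach (partial_dual G A)) H)) =
   orbits (flags G) (insert (free_side G) (insert (attach G) H))"
proof -
  have "{(x, h x) | x h. x \<in> flags G \<and>
          h \<in> insert (free_side (partial_dual G A)) (insert (attach (partial_dual G A)) H)} =
        {(x, h x) | x h. x \<in> flags G \<and> h \<in> insert (free_side G) (insert (attach G) H)}"
    (is "?L = ?R")
  proof (intro set_eqI)
    fix z :: "'a \<times> 'a"
    obtain x y where z: "z = (x, y)" by (cases z)
    have "y = free_side (partial_dual G A) x \<or> y = attach (partial_dual G A) x
      \<longleftrightarrow> y = free_side G x \<or> y = attach G x"
      by (auto simp: partial_dual_def)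
    then show "z \<in> ?L \<longleftrightarrow> z \<in> ?R" unfolding z by blast
  qed
  then show ?thesis by (simp add: orbits_def)
qed

lemma edges_partial_dual: "edges (partial_dual G A) = edges G"
proof -
  have "flags (partial_dual G A) = flags G" by (simp add: partial_dual_def)
  then show ?thesis by (simp add: edges_def orbits_partial_dual)
qed

lemma connected_rg_partial_dual: "connected_rg (partial_dual G A) \<longleftrightarrow> connected_rg G"
proof -
  have "flags (partial_dual G A) = flags G" "disc_arc (partial_dual G A) = disc_arc G"
    "n_bare (partial_dual G A) = n_bare G"
    by (simp_all add: partial_dual_def)
  then show ?thesis by (simp add: connected_rg_def orbits_partial_dual)
qed

lemma orientable_rg_partial_dual:
  assumes "orientable_rg G"
  shows "orientable_rg (partial_dual G A)"
proof -
  from assms obtain c :: "'a \<Rightarrow> bool" where "\<forall>f\<in>flags G.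
        c (free_side G f) \<noteq> c f \<and> c (attach G f) \<noteq> c f \<and> c (disc_arc G f) \<noteq> c f"
    unfolding orientable_rg_def by blast
  then have "\<forall>f\<in>flags (partial_dual G A).
        c (free_side (partial_dual G A) f) \<noteq> c f \<and> c (attach (partial_dual G A) f) \<noteq> c f \<and>
        c (disc_arc (partial_dual G A) f) \<noteq> c f"
    by (simp add: partial_dual_def)
  then show ?thesis
    unfolding orientable_rg_def by blast
qed

lemma orbits_closed:
  assumes "A \<subseteq> orbits X H" "x \<in> X" "h \<in> H" "x \<in> \<Union>A"
  shows "h x \<in> \<Union>A"
proof -
  let ?R = "{(x, h x) | x h. x \<in> X \<and> h \<in> H}"
  from assms(4) obtain Y where Y: "Y \<in> A" "x \<in> Y" by blast
  with assms(1) obtain y where y: "Y = ?R\<^sup>* `` {y}"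
    unfolding orbits_def quotient_def by blast
  have "(y, x) \<in> ?R\<^sup>*" using Y(2) y by blast
  moreover have "(x, h x) \<in> ?R" using assms(2,3) by blast
  ultimately have "h x \<in> Y" unfolding y by (blast intro: rtrancl_into_rtrancl)
  with Y(1) show ?thesis by blast
qed

lemma is_ribbon_graph_partial_dual:
  assumes "is_ribbon_graph G" "A \<subseteq> edges G"
  shows "is_ribbon_graph (partial_dual G A)"
proof -
  define U where "U = \<Union>A"
  have inv: "fpf_involution_on (flags G) (free_side G)" "fpf_involution_on (flags G) (attach G)"
    using assms(1) by (auto simp: is_ribbon_graph_def)
  have cl: "free_side G f \<in> U" "attach G f \<in> U" if "f \<in> flags G" "f \<in> U" for f
    using orbits_closed[OF assms(2)[unfolded edges_def]] that unfolding U_def by blast+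
  have free: "free_side G f \<in> U \<longleftrightarrow> f \<in> U" if "f \<in> flags G" for f
    using inv(1) cl(1)[of f] cl(1)[of "free_side G f"] that
    unfolding fpf_involution_on_def by auto
  have att: "attach G f \<in> U \<longleftrightarrow> f \<in> U" if "f \<in> flags G" for f
    using inv(2) cl(2)[of f] cl(2)[of "attach G f"] that
    unfolding fpf_involution_on_def by auto
  have dual: "partial_dual G A = G\<lparr>
     free_side := (\<lambda>f. if f \<in> U then attach G f else free_side G f),
     attach := (\<lambda>f. if f \<in> U then free_side G f else attach G f)\<rparr>"
    by (simp add: partial_dual_def U_def)
  have ne: "attach G f \<noteq> free_side G f" if "f \<in> flags G" for f
    using assms(1) that by (metis is_ribbon_graph_def)
  show ?thesis
    using assms(1) free att ne
    unfolding is_ribbon_graph_def fpf_involution_on_def dual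
    by simp
qed


subsection \<open>Cyclic order on the circle\<close>

lemma Arg2pi_circle:
  assumes "z \<in> circle" "p \<in> circle"
  shows "exp (\<i> * of_real (Arg2pi (z / p))) = z / p"
  using assms by (subst complex_norm_eq_1_exp[symmetric]) (simp add: norm_divide)

lemma Arg2pi_circle_inj:
  assumes "v \<in> circle" "q \<in> circle" "u \<in> circle" "Arg2pi (v / u) = Arg2pi (q / u)"
  shows "v = q"
proof -
  have "v / u = q / u"
    using Arg2pi_circle[OF assms(1,3)] Arg2pi_circle[OF assms(2,3)] unfolding assms(4)
    by (rule trans[OF sym])
  then show ?thesis using assms(3) by auto
qed

lemma Arg2pi_circle_self: "p \<in> circle \<Longrightarrow> Arg2pi (p / p) = 0"
  using Arg2pi_of_real[of 1] by (cases "p = 0") auto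

lemma Arg2pi_circle_pos:
  assumes "p \<in> circle" "q \<in> circle" "q \<noteq> p"
  shows "Arg2pi (q / p) > 0"
  using Arg2pi_circle_inj[OF assms(2,1,1)] Arg2pi_circle_self[OF assms(1)] assms(3)
    Arg2pi_ge_0[of "q / p"] by force

lemma Arg2pi_circle_diff:
  assumes "u \<in> circle" "v \<in> circle" "q \<in> circle" "Arg2pi (v / u) \<le> Arg2pi (q / u)"
  shows "Arg2pi (q / v) = Arg2pi (q / u) - Arg2pi (v / u)"
proof (rule Arg2pi_unique[where r = 1])
  have "u \<noteq> 0" using assms(1) by auto
  have "exp (\<i> * of_real (Arg2pi (q / u) - Arg2pi (v / u))) = (q / u) / (v / u)"
    by (simp only: of_real_diff right_diff_distrib exp_diff
        Arg2pi_circle[OF assms(3,1)] Arg2pi_circle[OF assms(2,1)])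
  then show "of_real 1 * exp (\<i> * of_real (Arg2pi (q / u) - Arg2pi (v / u))) = q / v"
    using \<open>u \<noteq> 0\<close> by simp
next
  show "Arg2pi (q / u) - Arg2pi (v / u) < 2 * pi"
    using Arg2pi_lt_2pi[of "q / u"] Arg2pi_ge_0[of "v / u"] by linarith
qed (use assms(4) in auto)

lemma Arg2pi_circle_swap:
  assumes "p \<in> circle" "q \<in> circle" "q \<noteq> p"
  shows "Arg2pi (p / q) = 2 * pi - Arg2pi (q / p)"
proof (rule Arg2pi_unique[where r = 1])
  have "exp (\<i> * of_real (2 * pi - Arg2pi (q / p))) =
      exp (of_real (2 * pi) * \<i>) / exp (\<i> * of_real (Arg2pi (q / p)))"
    by (simp only: of_real_diff right_diff_distrib exp_diff mult.commute[of \<i>])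
  also have "\<dots> = p / q"
    by (simp only: Arg2pi_circle[OF assms(2,1)] exp_two_pi_i' exp_two_pi_i) simp
  finally show "of_real 1 * exp (\<i> * of_real (2 * pi - Arg2pi (q / p))) = p / q"
    by simp
qed (use Arg2pi_circle_pos[OF assms] Arg2pi_lt_2pi[of "q / p"] in auto)

lemma ccw_arc_alt:
  assumes "p \<in> circle" "q \<in> circle" "q \<noteq> p"
  shows "ccw_arc q p = {z \<in> circle. Arg2pi (q / p) < Arg2pi (z / p)}"
proof (intro set_eqI iffI)
  fix z assume "z \<in> ccw_arc q p"
  then have z: "z \<in> circle" "0 < Arg2pi (z / q)" "Arg2pi (z / q) < Arg2pi (p / q)"
    by (auto simp: ccw_arc_def)
  have "z \<noteq> p" using z by auto
  have "Arg2pi (p / z) = Arg2pi (p / q) - Arg2pi (z / q)"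
    using Arg2pi_circle_diff[OF assms(2) z(1) assms(1)] z(3) by simp
  then show "z \<in> {z \<in> circle. Arg2pi (q / p) < Arg2pi (z / p)}"
    using Arg2pi_circle_swap[OF assms] Arg2pi_circle_swap[OF assms(1) z(1) \<open>z \<noteq> p\<close>] z by simp
next
  fix z assume "z \<in> {z \<in> circle. Arg2pi (q / p) < Arg2pi (z / p)}"
  then have z: "z \<in> circle" "Arg2pi (q / p) < Arg2pi (z / p)" by auto
  have "Arg2pi (z / q) = Arg2pi (z / p) - Arg2pi (q / p)"
    using Arg2pi_circle_diff[OF assms(1,2) z(1)] z(2) by simp
  then show "z \<in> ccw_arc q p"
    using Arg2pi_circle_swap[OF assms] Arg2pi_lt_2pi[of "z / p"] z by (simp add: ccw_arc_def)
qed

lemma ex1_next_pt: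
  assumes "finite P" "P \<subseteq> circle" "p \<in> P" "P - {p} \<noteq> {}"
  shows "\<exists>!q. q \<in> P - {p} \<and> ccw_arc p q \<inter> P = {}"
proof -
  let ?f = "\<lambda>q. Arg2pi (q / p)"
  obtain q where q: "q \<in> P - {p}" "\<And>x. x \<in> P - {p} \<Longrightarrow> ?f q \<le> ?f x"
    using assms(1,4) ex_is_arg_min_if_finite[of "P - {p}" ?f]
    by (auto simp: is_arg_min_linorder)
  have *: "ccw_arc p q' \<inter> P = {} \<longleftrightarrow> (\<forall>x\<in>P - {p}. ?f q' \<le> ?f x)" for q'
  proof -
    have "?f p = 0" using Arg2pi_circle_self assms by blast
    moreover have "?f x > 0" if "x \<in> P - {p}" for x
      using Arg2pi_circle_pos[of p x] assms that by blast
    ultimately show ?thesis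
      using assms(2,3) unfolding ccw_arc_def by (force simp: not_less[symmetric])
  qed
  show ?thesis
  proof (intro ex1I conjI)
    fix q' assume "q' \<in> P - {p} \<and> ccw_arc p q' \<inter> P = {}"
    then have "?f q' = ?f q" "q' \<in> P" using q * by (auto intro: antisym)
    then show "q' = q" using Arg2pi_circle_inj[of q' q p] q assms by blast
  qed (use q * in auto)
qed

lemma ex1_prev_pt:
  assumes "finite P" "P \<subseteq> circle" "p \<in> P" "P - {p} \<noteq> {}"
  shows "\<exists>!q. q \<in> P - {p} \<and> ccw_arc q p \<inter> P = {}"
proof -
  let ?f = "\<lambda>q. - Arg2pi (q / p)"
  obtain q where q: "q \<in> P - {p}" "\<And>x. x \<in> P - {p} \<Longrightarrow> ?f q \<le> ?f x"
    using assms(1,4) ex_is_arg_min_if_finite[of "P - {p}" ?f]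
    by (auto simp: is_arg_min_linorder)
  have *: "ccw_arc q' p \<inter> P = {} \<longleftrightarrow> (\<forall>x\<in>P - {p}. ?f q' \<le> ?f x)" if "q' \<in> P - {p}" for q'
  proof -
    have "Arg2pi (p / p) = 0" using Arg2pi_circle_self assms by blast
    moreover have "Arg2pi (q' / p) > 0"
      using Arg2pi_circle_pos[of p q'] assms that by blast
    moreover have "ccw_arc q' p = {z \<in> circle. Arg2pi (q' / p) < Arg2pi (z / p)}"
      using ccw_arc_alt[of p q'] assms that by blast
    ultimately show ?thesis
      using assms(2,3) by (force simp: not_less[symmetric])
  qed
  show ?thesis
  proof (intro ex1I conjI)
    fix q' assume "q' \<in> P - {p} \<and> ccw_arc q' p \<inter> P = {}"
    then have q': "q' \<in> P - {p}" "ccw_arc q' p \<inter> P = {}" by blast+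
    then have "?f q' \<le> ?f q" using * q(1) by blast
    with q(2)[OF q'(1)] have "Arg2pi (q' / p) = Arg2pi (q / p)" by simp
    then show "q' = q" using Arg2pi_circle_inj[of q' q p] q q' assms by blast
  next
    show "ccw_arc q p \<inter> P = {}" using q * by blast
  qed (use q in auto)
qed

lemma
  assumes "finite P" "P \<subseteq> circle" "p \<in> P" "P - {p} \<noteq> {}"
  shows next_pt: "next_pt P p \<in> P - {p}" "ccw_arc p (next_pt P p) \<inter> P = {}"
    and prev_pt: "prev_pt P p \<in> P - {p}" "ccw_arc (prev_pt P p) p \<inter> P = {}"
  using theI'[OF ex1_next_pt[OF assms]] theI'[OF ex1_prev_pt[OF assms]]
  unfolding next_pt_def prev_pt_def by blast+

lemma next_pt_eqI:
  assumes "finite P" "P \<subseteq> circle" "p \<in> P" "q \<in> P" "q \<noteq> p" "ccw_arc p q \<inter> P = {}"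
  shows "next_pt P p = q"
  unfolding next_pt_def
  by (rule the1_equality[OF ex1_next_pt]) (use assms in auto)

lemma prev_pt_eqI:
  assumes "finite P" "P \<subseteq> circle" "p \<in> P" "q \<in> P" "q \<noteq> p" "ccw_arc q p \<inter> P = {}"
  shows "prev_pt P p = q"
  unfolding prev_pt_def
  by (rule the1_equality[OF ex1_prev_pt]) (use assms in auto)

lemma
  assumes "finite P" "P \<subseteq> circle" "p \<in> P" "P - {p} \<noteq> {}"
  shows prev_next_pt: "prev_pt P (next_pt P p) = p"
    and next_prev_pt: "next_pt P (prev_pt P p) = p"
proof -
  have "next_pt P p \<in> P" "p \<noteq> next_pt P p" "prev_pt P p \<in> P" "p \<noteq> prev_pt P p"
    using next_pt(1)[OF assms] prev_pt(1)[OF assms] by auto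
  then show "prev_pt P (next_pt P p) = p" "next_pt P (prev_pt P p) = p"
    using next_pt(2)[OF assms] prev_pt(2)[OF assms] assms(3)
    by (auto intro!: prev_pt_eqI[OF assms(1,2)] next_pt_eqI[OF assms(1,2)])
qed

lemma next_pt_induct:
  assumes "finite P" "P \<subseteq> circle" "S \<subseteq> P" "S \<noteq> {}"
    and "\<And>p. p \<in> S \<Longrightarrow> next_pt P p \<in> S"
  shows "S = P"
proof (rule ccontr)
  assume "S \<noteq> P"
  then obtain q where q: "q \<in> P" "q \<notin> S" using assms(3) by blast
  have "finite S" using assms(1,3) finite_subset by blast
  then obtain u where u: "u \<in> S" "\<And>x. x \<in> S \<Longrightarrow> Arg2pi (q / u) \<le> Arg2pi (q / x)"
    using assms(4) ex_is_arg_min_if_finite[of S "\<lambda>u. Arg2pi (q / u)"]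
    by (auto simp: is_arg_min_linorder)
  let ?v = "next_pt P u"
  have "P - {u} \<noteq> {}" "u \<in> P" using q u(1) assms(3) by auto
  then have v: "?v \<in> P - {u}" "ccw_arc u ?v \<inter> P = {}"
    using next_pt[OF assms(1,2)] by blast+
  have c: "u \<in> circle" "?v \<in> circle" "q \<in> circle"
    using v(1) q(1) \<open>u \<in> P\<close> assms(2) by blast+
  have "q \<noteq> u" using q u by auto
  then have "0 < Arg2pi (q / u)" using Arg2pi_circle_pos c by blast
  then have "Arg2pi (?v / u) \<le> Arg2pi (q / u)"
    using v(2) q(1) c(3) unfolding ccw_arc_def by force
  then have "Arg2pi (q / ?v) = Arg2pi (q / u) - Arg2pi (?v / u)"
    using Arg2pi_circle_diff c by blast
  moreover have "Arg2pi (?v / u) > 0" using Arg2pi_circle_pos c v(1) by blast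
  ultimately show False using u(2)[OF assms(5)[OF u(1)]] by simp
qed


subsection \<open>Ribbon graphs of chord diagrams\<close>

lemma chord_diagram_ends:
  assumes "chord_diagram n D"
  shows "finite (\<Union>D)" "\<Union>D \<subseteq> circle" "p \<in> \<Union>D \<Longrightarrow> \<Union>D - {p} \<noteq> {}"
proof -
  have "finite c" if "c \<in> D" for c
    using assms that by (intro card_ge_0_finite) (simp add: chord_diagram_def)
  then show "finite (\<Union>D)" "\<Union>D \<subseteq> circle"
    using assms by (auto simp: chord_diagram_def)
  assume "p \<in> \<Union>D"
  then obtain c where c: "c \<in> D" by blast
  then have "card c = 2" using assms by (auto simp: chord_diagram_def)
  then have "\<not> c \<subseteq> {p}" by (auto simp: card_2_iff)
  with c show "\<Union>D - {p} \<noteq> {}" by blast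
qed

lemma other_end:
  assumes "chord_diagram n D" "p \<in> \<Union>D"
  shows "{p, other_end D p} \<in> D" "other_end D p \<noteq> p"
    and other_end_eqI: "{p, q} \<in> D \<Longrightarrow> other_end D p = q"
proof -
  have card: "card c = 2" if "c \<in> D" for c
    using assms(1) that by (auto simp: chord_diagram_def)
  obtain c where c: "c \<in> D" "p \<in> c" using assms(2) by blast
  then obtain q' where q': "c = {p, q'}" "q' \<noteq> p"
    using card[OF c(1)] by (auto simp: card_2_iff)
  have uniq: "q'' = q'" if "{p, q''} \<in> D" for q''
  proof -
    have "{p, q''} = c"
    proof (rule ccontr)
      assume "{p, q''} \<noteq> c"
      then have "{p, q''} \<inter> c = {}"
        using assms(1) that c(1) by (intro disjointD[of D]) (auto simp: chord_diagram_def)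
      then show False using c(2) by blast
    qed
    then show ?thesis using q' by auto
  qed
  have eq: "other_end D p = q'"
    unfolding other_end_def using c(1)[unfolded q'(1)] uniq by (rule the_equality)
  show "{p, other_end D p} \<in> D" "other_end D p \<noteq> p"
    using eq c q' by auto
  show "other_end D p = q" if "{p, q} \<in> D" using eq uniq that by blast
qed

lemma other_end_other_end:
  assumes "chord_diagram n D" "p \<in> \<Union>D"
  shows "other_end D (other_end D p) = p"
proof (rule other_end_eqI[OF assms(1)])
  have "{p, other_end D p} \<in> D" by (rule other_end(1)[OF assms])
  then show "other_end D p \<in> \<Union>D" "{other_end D p, p} \<in> D"
    by (blast, simp add: insert_commute)
qed

lemma is_ribbon_graph_of:
  assumes "chord_diagram n D"
  shows "is_ribbon_graph (ribbon_graph_of D)"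
proof -
  note P = chord_diagram_ends[OF assms]
  note nxt = next_pt[OF P(1,2)] and prv = prev_pt[OF P(1,2)]
  note oe = other_end[OF assms] other_end_other_end[OF assms]
  have "other_end D p \<in> \<Union>D" if "p \<in> \<Union>D" for p
    using oe(1)[OF that] by blast
  then have "fpf_involution_on (\<Union>D \<times> UNIV) (free_side (ribbon_graph_of D))"
    using oe by (auto simp del: Union_iff simp: fpf_involution_on_def ribbon_graph_of_def)
  moreover have "fpf_involution_on (\<Union>D \<times> UNIV) (attach (ribbon_graph_of D))"
    by (auto simp: fpf_involution_on_def ribbon_graph_of_def)
  moreover have "fpf_involution_on (\<Union>D \<times> UNIV) (disc_arc (ribbon_graph_of D))"
    unfolding fpf_involution_on_def
  proof (intro ballI)
    fix f assume "f \<in> \<Union>D \<times> (UNIV :: bool set)"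
    then obtain p d where f: "f = (p, d)" "p \<in> \<Union>D" by blast
    show "disc_arc (ribbon_graph_of D) f \<in> \<Union>D \<times> UNIV \<and>
        disc_arc (ribbon_graph_of D) f \<noteq> f \<and>
        disc_arc (ribbon_graph_of D) (disc_arc (ribbon_graph_of D) f) = f"
      using nxt(1)[OF f(2) P(3)[OF f(2)]] prv(1)[OF f(2) P(3)[OF f(2)]]
        prev_next_pt[OF P(1,2) f(2) P(3)[OF f(2)]] next_prev_pt[OF P(1,2) f(2) P(3)[OF f(2)]]
      by (cases d) (simp_all del: Union_iff add: f(1) ribbon_graph_of_def)
  qed
  moreover have "flags (ribbon_graph_of D) = \<Union>D \<times> UNIV" by (simp add: ribbon_graph_of_def)
  moreover have "\<forall>f\<in>\<Union>D \<times> UNIV.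
      free_side (ribbon_graph_of D) f \<noteq> attach (ribbon_graph_of D) f \<and>
      free_side (ribbon_graph_of D) (attach (ribbon_graph_of D) f) =
      attach (ribbon_graph_of D) (free_side (ribbon_graph_of D) f)"
    using oe(2) by (auto simp del: Union_iff simp: ribbon_graph_of_def)
  ultimately show ?thesis
    using P(1) by (simp add: is_ribbon_graph_def)
qed

lemma orientable_ribbon_graph_of: "orientable_rg (ribbon_graph_of D)"
  unfolding orientable_rg_def
  by (rule exI[of _ snd]) (auto simp: ribbon_graph_of_def)

lemma orbits_ribbon_graph_of:
  assumes "chord_diagram n D" "D \<noteq> {}"
    and H: "attach (ribbon_graph_of D) \<in> H" "disc_arc (ribbon_graph_of D) \<in> H"
    and closed: "\<And>f h. f \<in> flags (ribbon_graph_of D) \<Longrightarrow> h \<in> H \<Longrightarrow> h f \<in> flags (ribbon_graph_of D)"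
  shows "orbits (flags (ribbon_graph_of D)) H = {flags (ribbon_graph_of D)}"
proof -
  note P = chord_diagram_ends[OF assms(1)]
  let ?X = "flags (ribbon_graph_of D)"
  let ?R = "{(x, h x) | x h. x \<in> ?X \<and> h \<in> H}"
  have X: "?X = \<Union>D \<times> UNIV" by (simp add: ribbon_graph_of_def)
  have att: "((p, d), (p, \<not> d)) \<in> ?R" if "p \<in> \<Union>D" for p d
  proof -
    have "((p, d), attach (ribbon_graph_of D) (p, d)) \<in> ?R"
      using that H unfolding X by blast
    then show ?thesis by (simp add: ribbon_graph_of_def)
  qed
  have nxt: "((p, True), (next_pt (\<Union>D) p, False)) \<in> ?R" if "p \<in> \<Union>D" for p
  proof -
    have "((p, True), disc_arc (ribbon_graph_of D) (p, True)) \<in> ?R"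
      using that H unfolding X by blast
    then show ?thesis by (simp add: ribbon_graph_of_def)
  qed
  have class_eq: "?R\<^sup>* `` {f} = ?X" if f: "f \<in> ?X" for f
  proof (intro equalityI subsetI)
    fix g assume "g \<in> ?R\<^sup>* `` {f}"
    then have "(f, g) \<in> ?R\<^sup>*" by blast
    then show "g \<in> ?X"
      by (induction rule: rtrancl_induct) (use f closed in auto)
  next
    fix g assume g: "g \<in> ?X"
    define S where "S = {p \<in> \<Union>D. (f, (p, True)) \<in> ?R\<^sup>*}"
    obtain u d where u: "f = (u, d)" "u \<in> \<Union>D" using f unfolding X by blast
    have "u \<in> S" using att[OF u(2), of False] u by (cases d) (auto simp: S_def)
    moreover have "next_pt (\<Union>D) p \<in> S" if "p \<in> S" for p
    proof -
      have p: "p \<in> \<Union>D" "(f, (p, True)) \<in> ?R\<^sup>*" using that by (auto simp: S_def)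
      have n: "next_pt (\<Union>D) p \<in> \<Union>D" using next_pt(1)[OF P(1,2) p(1) P(3)[OF p(1)]] by blast
      have "(f, (next_pt (\<Union>D) p, False)) \<in> ?R\<^sup>*"
        using p(2) nxt[OF p(1)] by (rule rtrancl_into_rtrancl)
      then have "(f, (next_pt (\<Union>D) p, True)) \<in> ?R\<^sup>*"
        using att[OF n, of False] by (auto intro: rtrancl_into_rtrancl)
      with n show ?thesis by (simp add: S_def)
    qed
    ultimately have S: "S = \<Union>D" by (intro next_pt_induct[OF P(1,2)]) (auto simp: S_def)
    obtain q e where q: "g = (q, e)" "q \<in> \<Union>D" using g unfolding X by blast
    have "(f, (q, True)) \<in> ?R\<^sup>*" using q(2) S by (auto simp: S_def)
    moreover have "(f, (q, False)) \<in> ?R\<^sup>*"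
      using calculation att[OF q(2), of True] by (auto intro: rtrancl_into_rtrancl)
    ultimately show "g \<in> ?R\<^sup>* `` {f}" using q(1) by (cases e) auto
  qed
  obtain c where c: "c \<in> D" using assms(2) by blast
  then have "card c = 2" using assms(1) by (simp add: chord_diagram_def)
  then have "c \<noteq> {}" by auto
  then have "?X \<noteq> {}" using c unfolding X by blast
  then show ?thesis
    unfolding orbits_def quotient_def using class_eq by auto
qed

lemma
  assumes "chord_diagram n D"
  shows n_vertices_ribbon_graph_of: "n_vertices (ribbon_graph_of D) = 1"
    and connected_ribbon_graph_of: "connected_rg (ribbon_graph_of D)"
proof -
  let ?G = "ribbon_graph_of D"
  have "n_vertices ?G = 1 \<and> connected_rg ?G"
  proof (cases "D = {}")
    case True
    then show ?thesis
      by (simp add: n_vertices_def connected_rg_def orbits_def ribbon_graph_of_def)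
  next
    case False
    have closed: "h f \<in> flags ?G" if "f \<in> flags ?G" "h \<in> {free_side ?G, attach ?G, disc_arc ?G}"
      for f h
      using is_ribbon_graph_of[OF assms] that
      unfolding is_ribbon_graph_def fpf_involution_on_def by blast
    have "orbits (flags ?G) {attach ?G, disc_arc ?G} = {flags ?G}"
      by (rule orbits_ribbon_graph_of[OF assms False]) (use closed in auto)
    moreover have "orbits (flags ?G) {free_side ?G, attach ?G, disc_arc ?G} = {flags ?G}"
      by (rule orbits_ribbon_graph_of[OF assms False]) (use closed in auto)
    moreover have "n_bare ?G = 0" using False by (simp add: ribbon_graph_of_def)
    ultimately show ?thesis by (simp add: n_vertices_def connected_rg_def)
  qed
  then show "n_vertices ?G = 1" "connected_rg ?G" by blast+
qed

end

theory Submission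
  imports Defs
begin

text \<open>
  Going around the boundary of the spanning subgraph with chord set \<open>B\<close>, one alternately moves to
  the next chord end and, if its chord lies in \<open>B\<close>, jumps to the other end of that chord; hence
  boundary components are cycles of a permutation of the chord ends. By Euler's formula the genus of
  \<open>G\<^sup>A\<close> depends only on the number of chords and on the sum of these cycle numbers for \<open>A\<close> and for its
  complement. Up to complementation, let the new chord lie in \<open>A\<close>. If \<open>s\<close> does not, then the new end
  can slide past \<open>b\<close> and past \<open>r\<close>. If \<open>s\<close> does, then the new end can slide along the ribbon of \<open>s\<close>
  from \<open>b\<^sup>-\<close> to \<open>r\<^sup>+\<close> and from \<open>r\<^sup>-\<close> to \<open>b\<^sup>+\<close>. So for every \<open>A\<close> the four terms cancel in pairs.
\<close>

section \<open>Counting the components of a functional graph\<close>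

text \<open>\<open>f\<close> and \<open>g\<close> are inverse to each other only up to connection,
  so classes are pushed forward and then saturated. This gives mutually inverse maps between the
  components meeting \<open>X\<close> and those meeting \<open>Y\<close>.\<close>

lemma card_quotient_eq:
  fixes E :: "('a \<times> 'a) set" and F :: "('b \<times> 'b) set"
  assumes sym: "sym E" "sym F"
    and f: "\<And>x. x \<in> X \<Longrightarrow> f x \<in> Y" "\<And>x x'. (x, x') \<in> E \<Longrightarrow> (f x, f x') \<in> F\<^sup>*"
    and g: "\<And>y. y \<in> Y \<Longrightarrow> g y \<in> X" "\<And>y y'. (y, y') \<in> F \<Longrightarrow> (g y, g y') \<in> E\<^sup>*"
    and gf: "\<And>x. x \<in> X \<Longrightarrow> (x, g (f x)) \<in> E\<^sup>*"
    and fg: "\<And>y. y \<in> Y \<Longrightarrow> (y, f (g y)) \<in> F\<^sup>*"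
  shows "card (X // E\<^sup>*) = card (Y // F\<^sup>*)"
proof -
  have eE: "equiv UNIV (E\<^sup>*)" and eF: "equiv UNIV (F\<^sup>*)"
    using sym by (auto intro!: equivI sym_rtrancl simp: refl_rtrancl trans_rtrancl)
  have f': "(f x, f x') \<in> F\<^sup>*" if "(x, x') \<in> E\<^sup>*" for x x'
    using that by induction (simp, rule rtrancl_trans[OF _ f(2)])
  have g': "(g y, g y') \<in> E\<^sup>*" if "(y, y') \<in> F\<^sup>*" for y y'
    using that by induction (simp, rule rtrancl_trans[OF _ g(2)])
  have F_class: "F\<^sup>* `` (f ` (E\<^sup>* `` {x})) = F\<^sup>* `` {f x}" for x
    using f'[of x] by (blast intro: rtrancl_trans)
  have E_class: "E\<^sup>* `` (g ` (F\<^sup>* `` {y})) = E\<^sup>* `` {g y}" for y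
    using g'[of y] by (blast intro: rtrancl_trans)
  have "bij_betw (\<lambda>C. F\<^sup>* `` (f ` C)) (X // E\<^sup>*) (Y // F\<^sup>*)"
  proof (rule bij_betw_byWitness[where f' = "\<lambda>C. E\<^sup>* `` (g ` C)"])
    show "\<forall>C\<in>X // E\<^sup>*. E\<^sup>* `` (g ` (F\<^sup>* `` (f ` C))) = C"
      using equiv_class_eq[OF eE gf, symmetric] unfolding quotient_def
      by (simp add: F_class E_class)
    show "\<forall>C\<in>Y // F\<^sup>*. F\<^sup>* `` (f ` (E\<^sup>* `` (g ` C))) = C"
      using equiv_class_eq[OF eF fg, symmetric] unfolding quotient_def
      by (simp add: F_class E_class)
    show "(\<lambda>C. F\<^sup>* `` (f ` C)) ` (X // E\<^sup>*) \<subseteq> Y // F\<^sup>*"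
      using f(1) by (auto elim!: quotientE simp: F_class intro!: quotientI)
    show "(\<lambda>C. E\<^sup>* `` (g ` C)) ` (Y // F\<^sup>*) \<subseteq> X // E\<^sup>*"
      using g(1) by (auto elim!: quotientE simp: E_class intro!: quotientI)
  qed
  then show ?thesis by (rule bij_betw_same_card)
qed

text \<open>Both directions are included, so that the reflexive-transitive closure is an equivalence
  for every map, bijective or not.\<close>

definition step_rel :: "'a set \<Rightarrow> ('a \<Rightarrow> 'a) \<Rightarrow> ('a \<times> 'a) set" where
  "step_rel V \<phi> = (\<lambda>y. (y, \<phi> y)) ` V \<union> (\<lambda>y. (\<phi> y, y)) ` V"

text \<open>If \<open>\<phi>\<close> permutes a finite \<open>V\<close>, these components are the cycles of \<open>\<phi>\<close>.\<close>

definition n_cycles :: "'a set \<Rightarrow> ('a \<Rightarrow> 'a) \<Rightarrow> nat" where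
  "n_cycles V \<phi> = card (V // (step_rel V \<phi>)\<^sup>*)"

lemma sym_step_rel: "sym (step_rel V \<phi>)"
  by (auto simp: step_rel_def sym_def)

lemma step_relI: "y \<in> V \<Longrightarrow> (y, \<phi> y) \<in> step_rel V \<phi>" "y \<in> V \<Longrightarrow> (\<phi> y, y) \<in> step_rel V \<phi>"
  by (auto simp: step_rel_def)

lemma n_cycles_cong:
  assumes "\<And>y. y \<in> V \<Longrightarrow> \<phi> y = \<psi> y"
  shows "n_cycles V \<phi> = n_cycles V \<psi>"
proof -
  have "step_rel V \<phi> = step_rel V \<psi>"
    unfolding step_rel_def using assms by (intro arg_cong2[where f = "(\<union>)"] image_cong) auto
  then show ?thesis by (simp add: n_cycles_def)
qed

text \<open>Conjugation by an injection carries one functional graph onto the other.\<close>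

lemma n_cycles_rename:
  assumes "inj_on f V" "\<And>y. y \<in> V \<Longrightarrow> \<phi> y \<in> V" "\<And>y. y \<in> V \<Longrightarrow> \<psi> (f y) = f (\<phi> y)"
  shows "n_cycles V \<phi> = n_cycles (f ` V) \<psi>"
  unfolding n_cycles_def
proof (rule card_quotient_eq[where f = f and g = "inv_into V f"])
  fix x x' assume "(x, x') \<in> step_rel V \<phi>"
  then have "(f x, f x') \<in> step_rel (f ` V) \<psi>"
    unfolding step_rel_def using assms(3) by force
  then show "(f x, f x') \<in> (step_rel (f ` V) \<psi>)\<^sup>*" by blast
next
  fix y y' assume "(y, y') \<in> step_rel (f ` V) \<psi>"
  then have "(inv_into V f y, inv_into V f y') \<in> step_rel V \<phi>"
    unfolding step_rel_def using assms by auto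
  then show "(inv_into V f y, inv_into V f y') \<in> (step_rel V \<phi>)\<^sup>*" by blast
qed (use assms in \<open>auto simp: sym_step_rel inv_into_into f_inv_into_f\<close>)

text \<open>Cutting \<open>z\<close> out sends its predecessors straight to \<open>\<phi> z\<close>.
  As \<open>\<phi> z \<noteq> z\<close>, the component of \<open>z\<close> keeps the point
  \<open>\<phi> z\<close>, so no component is lost.\<close>

lemma n_cycles_remove:
  assumes "\<And>y. y \<in> V \<Longrightarrow> \<phi> y \<in> V" "z \<in> V" "\<phi> z \<noteq> z"
  shows "n_cycles V \<phi> = n_cycles (V - {z}) (\<lambda>y. if \<phi> y = z then \<phi> z else \<phi> y)"
    (is "_ = n_cycles ?W ?\<psi>")
  unfolding n_cycles_def
\<comment> \<open>\<open>f\<close> retracts \<open>z\<close> to its successor, and \<open>g\<close>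
  is the inclusion.\<close>
proof (rule card_quotient_eq[where f = "\<lambda>y. if y = z then \<phi> z else y" and g = id])
  let ?f = "\<lambda>y. if y = z then \<phi> z else y"
  fix x x' assume xx': "(x, x') \<in> step_rel V \<phi>"
  have "(?f y, ?f (\<phi> y)) \<in> (step_rel ?W ?\<psi>)\<^sup>* \<and> (?f (\<phi> y), ?f y) \<in> (step_rel ?W ?\<psi>)\<^sup>*"
    if "y \<in> V" for y
  proof (cases "y = z")
    case False
    then show ?thesis using step_relI[of y ?W ?\<psi>] that by (auto intro: r_into_rtrancl)
  qed (use assms in auto)
  then show "(?f x, ?f x') \<in> (step_rel ?W ?\<psi>)\<^sup>*"
    using xx' unfolding step_rel_def[of V] by blast
next
  fix x x' assume xx': "(x, x') \<in> step_rel ?W ?\<psi>"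
  have "(y, ?\<psi> y) \<in> (step_rel V \<phi>)\<^sup>* \<and> (?\<psi> y, y) \<in> (step_rel V \<phi>)\<^sup>*" if "y \<in> V" for y
  proof (cases "\<phi> y = z")
    case True
    have "(y, z) \<in> step_rel V \<phi>" "(z, y) \<in> step_rel V \<phi>"
      using step_relI[OF that, of \<phi>] True by simp_all
    with True step_relI[OF assms(2), of \<phi>] show ?thesis
      by (simp add: r_into_rtrancl rtrancl_trans[OF r_into_rtrancl r_into_rtrancl])
  qed (use step_relI[of y V \<phi>] that in \<open>auto intro: r_into_rtrancl\<close>)
  then have "(x, x') \<in> (step_rel V \<phi>)\<^sup>*"
    using xx' unfolding step_rel_def[of ?W] by blast
  then show "(id x, id x') \<in> (step_rel V \<phi>)\<^sup>*" by simp
next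
  fix x assume "x \<in> V"
  then show "(x, id (if x = z then \<phi> z else x)) \<in> (step_rel V \<phi>)\<^sup>*"
    using step_relI[of z V \<phi>] by auto
qed (use assms in \<open>auto simp: sym_step_rel\<close>)

text \<open>Two maps that pass through \<open>z\<close> in different ways are compared via the map
  that they share once \<open>z\<close> is cut out.\<close>

corollary n_cycles_eq_remove:
  assumes "\<And>y. y \<in> V \<Longrightarrow> \<phi> y \<in> V" "\<And>y. y \<in> V \<Longrightarrow> \<psi> y \<in> V" "z \<in> V" "\<phi> z \<noteq> z" "\<psi> z \<noteq> z"
    and "\<And>y. y \<in> V \<Longrightarrow> y \<noteq> z \<Longrightarrow>
      (if \<phi> y = z then \<phi> z else \<phi> y) = (if \<psi> y = z then \<psi> z else \<psi> y)"
  shows "n_cycles V \<phi> = n_cycles V \<psi>"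
proof -
  have "n_cycles V \<phi> = n_cycles (V - {z}) (\<lambda>y. if \<phi> y = z then \<phi> z else \<phi> y)"
    by (rule n_cycles_remove) (fact assms)+
  also have "\<dots> = n_cycles (V - {z}) (\<lambda>y. if \<psi> y = z then \<psi> z else \<psi> y)"
    by (rule n_cycles_cong) (rule assms(6), simp_all)
  also have "\<dots> = n_cycles V \<psi>"
    by (rule n_cycles_remove[symmetric]) (fact assms)+
  finally show ?thesis .
qed


section \<open>Sliding a chord end\<close>

text \<open>
  In both slides below, the two permutations agree after one chord end (\<open>b\<close> or \<open>r\<close>) is removed from
  its cycle, which does not change the number of cycles.
\<close>

definition insert_after :: "'a \<Rightarrow> 'a \<Rightarrow> ('a \<Rightarrow> 'a) \<Rightarrow> 'a \<Rightarrow> 'a" where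
  "insert_after l x c y = (if y = x then c l else if y = l then x else c y)"

text \<open>While \<open>insert_after\<close> puts the new point into the gap between
  \<open>l\<close> and \<open>c l\<close>, \<open>link\<close> extends the involution
  \<open>\<rho>\<close> by the transposition of \<open>a\<close> and \<open>x\<close>, that is, by
  the new chord.\<close>

definition link :: "'a \<Rightarrow> 'a \<Rightarrow> ('a \<Rightarrow> 'a) \<Rightarrow> 'a \<Rightarrow> 'a" where
  "link a x \<rho> y = (if y = a then x else if y = x then a else \<rho> y)"

text \<open>Models the situation before the new chord is drawn: \<open>P\<close> holds the ends of
  \<open>D\<close> together with \<open>a\<close>, \<open>c\<close> is the successor in cyclic
  order, and \<open>\<rho>\<close> swaps the ends of the selected chords. The point \<open>a\<close>
  is present but still unpaired, so all four diagrams share the same data.\<close>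

locale cyclic_pairing =
  fixes P :: "'a set" and c \<rho> :: "'a \<Rightarrow> 'a" and a :: 'a
  assumes c_in: "y \<in> P \<Longrightarrow> c y \<in> P"
    and c_inj: "y \<in> P \<Longrightarrow> y' \<in> P \<Longrightarrow> c y = c y' \<Longrightarrow> y = y'"
    and c_ne: "y \<in> P \<Longrightarrow> c y \<noteq> y"
    and rho_in: "y \<in> P \<Longrightarrow> \<rho> y \<in> P"
    and rho_rho: "y \<in> P \<Longrightarrow> \<rho> (\<rho> y) = y"
    and a: "a \<in> P" "\<rho> a = a"
begin

text \<open>Boundary components of a spanning subgraph that contains the new chord, whose second end
  \<open>x\<close> follows \<open>l\<close>.\<close>

abbreviation "cyc l x \<equiv> n_cycles (insert x P) (link a x \<rho> \<circ> insert_after l x c)"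

text \<open>Only the gap into which the new end falls matters, not the point chosen in it.\<close>

lemma rename:
  assumes "x \<notin> P" "x' \<notin> P" "l \<in> P"
  shows "cyc l x = cyc l x'"
proof -
  define f where "f = (\<lambda>y. if y = x then x' else y)"
  have im: "f ` insert x P = insert x' P" using assms by (force simp: f_def)
  have nm: "y \<in> P \<Longrightarrow> y \<noteq> x \<and> y \<noteq> x'" for y using assms by blast
  show ?thesis
    unfolding im[symmetric]
  proof (rule n_cycles_rename)
    show "inj_on f (insert x P)" using assms by (auto simp: inj_on_def f_def)
  next
    fix y assume "y \<in> insert x P"
    then show "(link a x \<rho> \<circ> insert_after l x c) y \<in> insert x P"
      using c_in rho_in a assms by (auto simp: link_def insert_after_def)
  next
    fix y assume "y \<in> insert x P"
    then show "(link a x' \<rho> \<circ> insert_after l x' c) (f y) = f ((link a x \<rho> \<circ> insert_after l x c) y)"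
      using nm[OF c_in] nm[OF rho_in[OF c_in]] nm[OF a(1)] nm[of y] assms nm[OF assms(3)]
      by (auto simp: link_def insert_after_def f_def)
  qed
qed

text \<open>If the new chord is not selected, its end \<open>x\<close> is merely passed through and
  can be cut out. The result involves neither \<open>l\<close> nor \<open>x\<close>, so this count
  is common to the four diagrams.\<close>

lemma unlinked:
  assumes "x \<notin> P" "l \<in> P" "\<rho>' x = x" "\<And>y. y \<in> P \<Longrightarrow> \<rho>' y = \<rho> y"
  shows "n_cycles (insert x P) (\<rho>' \<circ> insert_after l x c) = n_cycles P (\<rho> \<circ> c)"
proof -
  have nm: "y \<in> P \<Longrightarrow> y \<noteq> x" for y using assms by blast
  let ?\<phi> = "\<rho>' \<circ> insert_after l x c"
  have "n_cycles (insert x P) ?\<phi> =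
      n_cycles (insert x P - {x}) (\<lambda>y. if ?\<phi> y = x then ?\<phi> x else ?\<phi> y)"
    using nm[OF rho_in[OF c_in]] c_in rho_in assms
    by (intro n_cycles_remove) (auto simp: insert_after_def)
  also have "\<dots> = n_cycles (insert x P - {x}) (\<rho> \<circ> c)"
    using nm[OF rho_in[OF c_in]] nm c_in assms by (intro n_cycles_cong) (auto simp: insert_after_def)
  also have "insert x P - {x} = P" using assms by blast
  finally show ?thesis .
qed

text \<open>As \<open>\<rho>\<close> fixes \<open>b\<close>, the point \<open>b\<close> follows
  \<open>x\<close> when \<open>x\<close> comes after \<open>p\<close>, and follows \<open>p\<close>
  when \<open>x\<close> comes after \<open>b\<close>. Cutting \<open>b\<close> out leaves the same
  map: \<open>p\<close> goes to \<open>a\<close>, and \<open>x\<close> goes where \<open>c b\<close>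
  is linked.\<close>

lemma slide_past_end:
  assumes "x \<notin> P" "p \<in> P" "c p = b" "\<rho> b = b" "b \<noteq> a"
  shows "cyc p x = cyc b x"
proof -
  have nm: "y \<in> P \<Longrightarrow> y \<noteq> x" for y using assms by blast
  have b: "b \<in> P" "p \<noteq> b" using c_in[OF assms(2)] c_ne[OF assms(2)] assms by auto
  have cb: "c y = b \<longleftrightarrow> y = p" if "y \<in> P" for y using c_inj assms that by blast
  have rb: "\<rho> y = b \<longleftrightarrow> y = b" "\<rho> y = a \<longleftrightarrow> y = a" if "y \<in> P" for y
    using rho_rho[OF that] assms a by metis+
  note cin = c_in[OF b(1)] c_ne[OF b(1)] nm[OF a(1)] nm[OF b(1)] nm[OF assms(2)]
  show ?thesis
  proof (rule n_cycles_eq_remove[where z = b])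
    show "(link a x \<rho> \<circ> insert_after p x c) y \<in> insert x P"
      "(link a x \<rho> \<circ> insert_after b x c) y \<in> insert x P" if "y \<in> insert x P" for y
      using that c_in rho_in a assms b by (auto simp: link_def insert_after_def)
    show "(link a x \<rho> \<circ> insert_after p x c) b \<noteq> b" "(link a x \<rho> \<circ> insert_after b x c) b \<noteq> b"
      using b cin assms rb[OF cin(1)] by (auto simp: link_def insert_after_def)
  next
    fix y assume y: "y \<in> insert x P" "y \<noteq> b"
    show "(if (link a x \<rho> \<circ> insert_after p x c) y = b then (link a x \<rho> \<circ> insert_after p x c) b
          else (link a x \<rho> \<circ> insert_after p x c) y) =
        (if (link a x \<rho> \<circ> insert_after b x c) y = b then (link a x \<rho> \<circ> insert_after b x c) b
          else (link a x \<rho> \<circ> insert_after b x c) y)"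
      using y b cin assms rb[OF cin(1)] cb rb[OF c_in] nm[OF c_in]
      by (auto simp: link_def insert_after_def)
  qed (use b in auto)
qed

text \<open>Arriving at \<open>b\<close> now means jumping to \<open>r\<close>, so \<open>r\<close>
  takes over the role of the point to be cut out. Both maps then send \<open>p\<close> to
  \<open>a\<close> and \<open>x\<close> to where \<open>c r\<close> is linked, unless
  \<open>p = r\<close>, when the two sides coincide anyway.\<close>

lemma slide_along_chord:
  assumes "x \<notin> P" "p \<in> P" "c p = b" "r \<in> P" "\<rho> b = r" "b \<noteq> r"
  shows "cyc p x = cyc r x"
proof -
  have nm: "y \<in> P \<Longrightarrow> y \<noteq> x" for y using assms by blast
  have b: "b \<in> P" "p \<noteq> b" using c_in[OF assms(2)] c_ne[OF assms(2)] assms by auto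
  have rr: "\<rho> r = b" using rho_rho b(1) assms by auto
  have ab: "a \<noteq> b" "a \<noteq> r" "c p \<noteq> a" using a assms rr by auto
  have cb: "c y = b \<longleftrightarrow> y = p" if "y \<in> P" for y using c_inj assms that by blast
  have rb: "\<rho> y = r \<longleftrightarrow> y = b" "\<rho> y = a \<longleftrightarrow> y = a" if "y \<in> P" for y
    using rho_rho[OF that] assms a rr by metis+
  note cin = c_in[OF assms(4)] c_ne[OF assms(4)] nm[OF a(1)] nm[OF b(1)] nm[OF assms(2)]
    nm[OF assms(4)]
  show ?thesis
  proof (rule n_cycles_eq_remove[where z = r])
    show "(link a x \<rho> \<circ> insert_after p x c) y \<in> insert x P"
      "(link a x \<rho> \<circ> insert_after r x c) y \<in> insert x P" if "y \<in> insert x P" for y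
      using that c_in rho_in a assms b by (auto simp: link_def insert_after_def)
    show "(link a x \<rho> \<circ> insert_after p x c) r \<noteq> r" "(link a x \<rho> \<circ> insert_after r x c) r \<noteq> r"
      using b cin assms rb[OF cin(1)] ab cb[OF assms(4)] by (auto simp: link_def insert_after_def)
  next
    fix y assume y: "y \<in> insert x P" "y \<noteq> r"
    show "(if (link a x \<rho> \<circ> insert_after p x c) y = r then (link a x \<rho> \<circ> insert_after p x c) r
          else (link a x \<rho> \<circ> insert_after p x c) y) =
        (if (link a x \<rho> \<circ> insert_after r x c) y = r then (link a x \<rho> \<circ> insert_after r x c) r
          else (link a x \<rho> \<circ> insert_after r x c) y)"
      using y b cin assms rb[OF cin(1)] cb cb[OF assms(4)] rb[OF c_in] nm[OF c_in] ab
      by (auto simp: link_def insert_after_def)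
  qed (use assms in auto)
qed

end

section \<open>Inserting a point into the cyclic order\<close>

lemma ccw_arc_mono:
  assumes "x \<in> ccw_arc p q" "p \<in> circle" "q \<in> circle" "p \<noteq> q"
  shows "ccw_arc p x \<subseteq> ccw_arc p q" "ccw_arc x q \<subseteq> ccw_arc p q" "x \<noteq> p" "x \<noteq> q" "x \<in> circle"
proof -
  show x: "x \<noteq> p" "x \<noteq> q" "x \<in> circle"
    using assms(1) Arg2pi_circle_self[OF assms(2)] by (auto simp: ccw_arc_def)
  show "ccw_arc p x \<subseteq> ccw_arc p q" using assms(1) by (auto simp: ccw_arc_def)
  show "ccw_arc x q \<subseteq> ccw_arc p q"
    using assms(1) ccw_arc_alt[OF assms(3) x(3,2)] ccw_arc_alt[OF assms(3,2,4)] by auto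
qed

lemma self_notin_ccw_arc: "x \<in> circle \<Longrightarrow> x \<notin> ccw_arc x q" "x \<notin> ccw_arc q x"
  using Arg2pi_circle_self[of x] by (auto simp: ccw_arc_def)

text \<open>The new point splits the gap after \<open>l\<close> in two and leaves every other gap
  untouched.\<close>

lemma next_pt_insert:
  assumes P: "finite P" "P \<subseteq> circle" and l: "l \<in> P" "P - {l} \<noteq> {}"
    and x: "x \<notin> P" "x \<in> ccw_arc l (next_pt P l)" and y: "y \<in> insert x P"
  shows "next_pt (insert x P) y = insert_after l x (next_pt P) y"
proof -
  let ?q = "next_pt P l"
  have q: "?q \<in> P" "?q \<noteq> l" "ccw_arc l ?q \<inter> P = {}"
    using next_pt[OF P l] by auto
  have lq: "l \<in> circle" "?q \<in> circle" "l \<noteq> ?q" using P l q by auto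
  note mono = ccw_arc_mono[OF x(2) lq]
  have P': "finite (insert x P)" "insert x P \<subseteq> circle" using P mono(5) by auto
  have "ccw_arc l x \<inter> insert x P = {}" "ccw_arc x ?q \<inter> insert x P = {}"
    using mono q self_notin_ccw_arc by blast+
  then have *: "next_pt (insert x P) l = x" "next_pt (insert x P) x = ?q"
    using l q x by (auto intro!: next_pt_eqI[OF P'])
  \<comment> \<open>Uniqueness of the gap containing \<open>x\<close>: the start of any such gap is
    the predecessor of \<open>x\<close>. Hence no gap starting at a point other than
    \<open>l\<close> contains \<open>x\<close>.\<close>
  have prev: "prev_pt (insert x P) x = u"
    if u: "u \<in> P" "x \<in> ccw_arc u (next_pt P u)" for u
  proof -
    have "P - {u} \<noteq> {}" using l q by auto
    note n = next_pt[OF P u(1) this]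
    have "u \<in> circle" "next_pt P u \<in> circle" "u \<noteq> next_pt P u" using n u P by auto
    from ccw_arc_mono[OF u(2) this] have "ccw_arc u x \<inter> insert x P = {}"
      using n(2) self_notin_ccw_arc(2)[of x u] by blast
    then show ?thesis using u x by (intro prev_pt_eqI[OF P']) auto
  qed
  have "next_pt (insert x P) y = next_pt P y" if "y \<noteq> x" "y \<noteq> l"
  proof -
    have yP: "y \<in> P" "P - {y} \<noteq> {}" using that y l by auto
    note n = next_pt[OF P yP]
    have "x \<notin> ccw_arc y (next_pt P y)" using prev[OF yP(1)] prev[OF l(1) x(2)] that by auto
    then show ?thesis using n yP by (intro next_pt_eqI[OF P']) auto
  qed
  with * show ?thesis by (simp add: insert_after_def)
qed

text \<open>Turns closeness to \<open>p\<close> into membership in a gap of \<open>P\<close>.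
  Measured from \<open>p\<close>, the next point does not come before \<open>x\<close>, and it
  differs from \<open>x\<close> because \<open>x \<notin> P\<close>.\<close>

lemma immediately_after_in_ccw_arc:
  assumes "finite P" "P \<subseteq> circle" "p \<in> P" "P - {p} \<noteq> {}" "immediately_after P p x"
  shows "x \<in> ccw_arc p (next_pt P p)"
proof -
  have x: "x \<in> circle" "x \<noteq> p" "x \<notin> P" "ccw_arc p x \<inter> P = {}"
    using assms(5) by (auto simp: immediately_after_def)
  let ?q = "next_pt P p"
  have q: "?q \<in> P" "?q \<noteq> p" using next_pt(1)[OF assms(1-4)] by auto
  have c: "p \<in> circle" "?q \<in> circle" using assms q by auto
  have "?q \<notin> ccw_arc p x" using x q by blast
  then have "Arg2pi (x / p) \<le> Arg2pi (?q / p)"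
    using c Arg2pi_circle_pos[OF c q(2)] by (auto simp: ccw_arc_def)
  moreover have "Arg2pi (x / p) \<noteq> Arg2pi (?q / p)"
    using Arg2pi_circle_inj[OF x(1) c(2,1)] x(3) q(1) by auto
  ultimately show ?thesis
    using x Arg2pi_circle_pos[OF c(1) x(1,2)] by (simp add: ccw_arc_def)
qed

text \<open>The mirror image. Angles are still measured from \<open>p\<close>: by
  \<open>ccw_arc_alt\<close>, arcs ending at \<open>p\<close> are strict lower bounds on this
  angle.\<close>

lemma immediately_before_in_ccw_arc:
  assumes "finite P" "P \<subseteq> circle" "p \<in> P" "P - {p} \<noteq> {}" "immediately_before P p x"
  shows "x \<in> ccw_arc (prev_pt P p) p"
proof -
  have x: "x \<in> circle" "x \<noteq> p" "x \<notin> P" "ccw_arc x p \<inter> P = {}"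
    using assms(5) by (auto simp: immediately_before_def)
  let ?q = "prev_pt P p"
  have q: "?q \<in> P" "?q \<noteq> p" using prev_pt(1)[OF assms(1-4)] by auto
  have c: "p \<in> circle" "?q \<in> circle" using assms q by auto
  have "?q \<notin> ccw_arc x p" using x q by blast
  then have "Arg2pi (?q / p) \<le> Arg2pi (x / p)"
    using c ccw_arc_alt[OF c(1) x(1,2)] by auto
  moreover have "Arg2pi (x / p) \<noteq> Arg2pi (?q / p)"
    using Arg2pi_circle_inj[OF x(1) c(2,1)] x(3) q(1) by auto
  ultimately show ?thesis
    using x ccw_arc_alt[OF c q(2)] by simp
qed

section \<open>Partial-dual genus polynomials of chord diagrams\<close>

text \<open>From \<open>(p, True)\<close>, \<open>k\<close> leads to \<open>(n p, False)\<close> and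
  then \<open>h\<close> to \<open>(\<tau> (n p), True)\<close>. Thus the \<open>True\<close> flags
  of an orbit trace a cycle of \<open>\<tau> \<circ> n\<close>.\<close>

lemma card_orbits_eq_n_cycles:
  fixes h k :: "'a \<times> bool \<Rightarrow> 'a \<times> bool"
  assumes n: "\<And>p. p \<in> P \<Longrightarrow> n p \<in> P" "\<And>p. p \<in> P \<Longrightarrow> m (n p) = p"
    and m: "\<And>p. p \<in> P \<Longrightarrow> m p \<in> P" "\<And>p. p \<in> P \<Longrightarrow> n (m p) = p"
    and \<tau>: "\<And>p. p \<in> P \<Longrightarrow> \<tau> p \<in> P" "\<And>p. p \<in> P \<Longrightarrow> \<tau> (\<tau> p) = p"
    and h: "\<And>p d. p \<in> P \<Longrightarrow> h (p, d) = (\<tau> p, \<not> d)"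
    and k: "\<And>p. p \<in> P \<Longrightarrow> k (p, True) = (n p, False)" "\<And>p. p \<in> P \<Longrightarrow> k (p, False) = (m p, True)"
  shows "card (orbits (P \<times> UNIV) {h, k}) = n_cycles P (\<tau> \<circ> n)"
proof -
  define E where "E = {(x, g x) | x g. x \<in> P \<times> (UNIV :: bool set) \<and> g \<in> {h, k}}"
  \<comment> \<open>A \<open>False\<close> flag is represented by the \<open>True\<close> flag that
    \<open>k\<close> joins to it.\<close>
  define f where "f = (\<lambda>(p, d). if d then p else m p)"
  let ?F = "step_rel P (\<tau> \<circ> n)"
  have hE: "((p, d), (\<tau> p, \<not> d)) \<in> E" if "p \<in> P" for p d
  proof -
    have "((p, d), h (p, d)) \<in> E" using that unfolding E_def by blast
    then show ?thesis using h that by simp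
  qed
  have kE: "((p, True), (n p, False)) \<in> E" "((p, False), (m p, True)) \<in> E" if "p \<in> P" for p
  proof -
    have "((p, True), k (p, True)) \<in> E" "((p, False), k (p, False)) \<in> E"
      using that unfolding E_def by blast+
    then show "((p, True), (n p, False)) \<in> E" "((p, False), (m p, True)) \<in> E"
      using k that by simp_all
  qed
  have E_cases: "\<exists>p\<in>P. x = (p, True) \<and> (y = (\<tau> p, False) \<or> y = (n p, False)) \<or>
      x = (p, False) \<and> (y = (\<tau> p, True) \<or> y = (m p, True))" if xy: "(x, y) \<in> E" for x y
  proof -
    obtain p d where "x = (p, d)" "p \<in> P" "y = h (p, d) \<or> y = k (p, d)"
      using xy unfolding E_def by auto
    then show ?thesis using h k by (cases d) auto
  qed
  have "sym E"
  proof (rule symI)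
    fix x y assume "(x, y) \<in> E"
    from E_cases[OF this] obtain p where p: "p \<in> P"
      and *: "x = (p, True) \<and> (y = (\<tau> p, False) \<or> y = (n p, False)) \<or>
        x = (p, False) \<and> (y = (\<tau> p, True) \<or> y = (m p, True))" ..
    have "((\<tau> p, d), (p, \<not> d)) \<in> E" for d using hE[OF \<tau>(1)[OF p]] \<tau>(2)[OF p] by simp
    from this[of True] this[of False]
    have "((\<tau> p, True), (p, False)) \<in> E" "((\<tau> p, False), (p, True)) \<in> E" by simp_all
    moreover have "((m p, True), (p, False)) \<in> E" "((n p, False), (p, True)) \<in> E"
      using kE(1)[OF m(1)[OF p]] m(2)[OF p] kE(2)[OF n(1)[OF p]] n(2)[OF p] by simp_all
    ultimately show "(y, x) \<in> E" using * by blast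
  qed
  have "card ((P \<times> UNIV) // E\<^sup>*) = card (P // ?F\<^sup>*)"
  proof (rule card_quotient_eq[where f = f and g = "\<lambda>p. (p, True)"])
    fix x y assume "(x, y) \<in> E"
    from E_cases[OF this] show "(f x, f y) \<in> ?F\<^sup>*"
    proof (elim bexE)
      fix p assume "p \<in> P" and *: "x = (p, True) \<and> (y = (\<tau> p, False) \<or> y = (n p, False)) \<or>
        x = (p, False) \<and> (y = (\<tau> p, True) \<or> y = (m p, True))"
      \<comment> \<open>These are the images of the two kinds of \<open>h\<close>-steps;
        \<open>k\<close>-steps collapse to a point.\<close>
      have "(p, m (\<tau> p)) \<in> ?F" "(m p, \<tau> p) \<in> ?F"
        using step_relI(2)[of "m (\<tau> p)" P "\<tau> \<circ> n"] step_relI(1)[of "m p" P "\<tau> \<circ> n"]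
        by (simp_all add: m \<tau> \<open>p \<in> P\<close>)
      then show ?thesis using * n(2)[OF \<open>p \<in> P\<close>] by (auto simp: f_def)
    qed
  next
    fix p q assume pq: "(p, q) \<in> ?F"
    have "((u, True), (\<tau> (n u), True)) \<in> E\<^sup>*" if "u \<in> P" for u
      using kE(1)[OF that] hE[OF n(1)[OF that], of False]
      by (simp add: rtrancl_trans[OF r_into_rtrancl r_into_rtrancl])
    then have "((u, True), (\<tau> (n u), True)) \<in> E\<^sup>* \<and> ((\<tau> (n u), True), (u, True)) \<in> E\<^sup>*" if "u \<in> P" for u
      using that symD[OF sym_rtrancl[OF \<open>sym E\<close>]] by blast
    then show "((p, True), (q, True)) \<in> E\<^sup>*"
      using pq unfolding step_rel_def comp_def by blast
  next
    fix x assume "x \<in> P \<times> (UNIV :: bool set)"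
    then obtain p d where "x = (p, d)" "p \<in> P" by auto
    then show "(x, (f x, True)) \<in> E\<^sup>*" using kE(2) by (cases d) (auto simp: f_def)
  qed (use \<open>sym E\<close> sym_step_rel m in \<open>auto simp: f_def\<close>)
  then show ?thesis by (simp add: orbits_def E_def n_cycles_def)
qed

text \<open>\<open>attach\<close> flips the side at one end and \<open>free_side\<close> moves to
  the other end, so the four flags over a chord form a single orbit.\<close>

lemma edges_ribbon_graph_of:
  assumes "chord_diagram n D"
  shows "edges (ribbon_graph_of D) = (\<lambda>c. c \<times> UNIV) ` D"
proof -
  let ?G = "ribbon_graph_of D"
  define E where "E = {(x, g x) | x g. x \<in> flags ?G \<and> g \<in> {free_side ?G, attach ?G}}"
  have E: "(x, y) \<in> E \<longleftrightarrow> (\<exists>p\<in>\<Union>D. \<exists>d. x = (p, d) \<and> (y = (other_end D p, \<not> d) \<or> y = (p, \<not> d)))" for x y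
  proof -
    have "(x, y) \<in> E \<longleftrightarrow> x \<in> \<Union>D \<times> UNIV \<and> (y = free_side ?G x \<or> y = attach ?G x)"
    proof -
      have "flags ?G = \<Union>D \<times> UNIV" by (simp add: ribbon_graph_of_def)
      then show ?thesis unfolding E_def by blast
    qed
    then show ?thesis by (cases x) (simp del: Union_iff add: ribbon_graph_of_def)
  qed
  note oe = other_end[OF assms] other_end_other_end[OF assms]
  have oe_in: "other_end D p \<in> \<Union>D" if "p \<in> \<Union>D" for p using oe(1)[OF that] by blast
  have cls: "E\<^sup>* `` {(p, d)} = {p, other_end D p} \<times> UNIV" if p: "p \<in> \<Union>D" for p d
  proof (intro equalityI subsetI)
    fix y assume "y \<in> E\<^sup>* `` {(p, d)}"
    then have "((p, d), y) \<in> E\<^sup>*" by blast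
    then show "y \<in> {p, other_end D p} \<times> UNIV"
    proof induction
      case (step y z)
      then show ?case using oe(4)[OF p] unfolding E by auto
    qed simp
  next
    fix y assume "y \<in> {p, other_end D p} \<times> (UNIV :: bool set)"
    then obtain q e where y: "y = (q, e)" "q = p \<or> q = other_end D p" by auto
    have "((p, d), (p, \<not> d)) \<in> E" "((p, d), (other_end D p, \<not> d)) \<in> E"
      "((other_end D p, \<not> d), (other_end D p, d)) \<in> E"
      using p oe_in[OF p] unfolding E by blast+
    then have "((p, d), (p, \<not> d)) \<in> E\<^sup>*" "((p, d), (other_end D p, \<not> d)) \<in> E\<^sup>*"
      "((p, d), (other_end D p, d)) \<in> E\<^sup>*"
      by (blast intro: rtrancl_into_rtrancl)+
    then show "y \<in> E\<^sup>* `` {(p, d)}" using y by (cases "e = d") auto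
  qed
  have "edges ?G = (\<lambda>x. E\<^sup>* `` {x}) ` flags ?G"
    by (simp add: edges_def orbits_def E_def quotient_def UNION_singleton_eq_range)
  also have "flags ?G = \<Union>D \<times> UNIV" by (simp add: ribbon_graph_of_def)
  also have "(\<lambda>x. E\<^sup>* `` {x}) ` (\<Union>D \<times> UNIV) =
      (\<lambda>x. {fst x, other_end D (fst x)} \<times> UNIV) ` (\<Union>D \<times> (UNIV :: bool set))"
    using cls by (intro image_cong refl) (simp only: mem_Times_iff split_paired_all fst_conv)
  also have "\<dots> = (\<lambda>p. {p, other_end D p} \<times> UNIV) ` fst ` (\<Union>D \<times> (UNIV :: bool set))"
    by (simp only: image_image)
  also have "fst ` (\<Union>D \<times> (UNIV :: bool set)) = \<Union>D" by simp
  also have "(\<lambda>p. {p, other_end D p} \<times> UNIV) ` \<Union>D = (\<lambda>c. c \<times> UNIV) ` (\<lambda>p. {p, other_end D p}) ` \<Union>D" by (simp only: image_image)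
  also have "(\<lambda>p. {p, other_end D p}) ` \<Union>D = D"
  proof (intro equalityI subsetI)
    fix c assume c: "c \<in> D"
    then have "card c = 2" using assms by (auto simp: chord_diagram_def)
    then obtain p q where pq: "c = {p, q}" by (auto simp: card_2_iff)
    then have "p \<in> \<Union>D" using c by blast
    moreover have "other_end D p = q" using oe(3)[OF calculation] c pq by blast
    ultimately show "c \<in> (\<lambda>p. {p, other_end D p}) ` \<Union>D" using pq by blast
  qed (use oe(1) in blast)
  finally show ?thesis .
qed

text \<open>The jump made by the boundary of the spanning subgraph with chord set \<open>B\<close>.
  At an end of any other chord it runs along the attaching segment, hence the fixed points.\<close>

definition swap_ends :: "complex set set \<Rightarrow> complex set set \<Rightarrow> complex \<Rightarrow> complex" where
  "swap_ends D B p = (if p \<in> \<Union>B then other_end D p else p)"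

lemma swap_ends:
  assumes "chord_diagram n D" "B \<subseteq> D" "p \<in> \<Union>D"
  shows "swap_ends D B p \<in> \<Union>D" "swap_ends D B (swap_ends D B p) = p"
proof -
  note oe = other_end[OF assms(1)] other_end_other_end[OF assms(1)]
  have "other_end D p \<in> \<Union>B" if p: "p \<in> \<Union>B"
  proof -
    obtain c where c: "c \<in> B" "p \<in> c" using p by blast
    then have "card c = 2" using assms by (auto simp: chord_diagram_def)
    then obtain q where pq: "c = {p, q}" using c(2) by (auto simp: card_2_iff)
    then have "other_end D p = q" using oe(3)[OF assms(3)] c assms by blast
    then show ?thesis using pq c by blast
  qed
  then show "swap_ends D B p \<in> \<Union>D" "swap_ends D B (swap_ends D B p) = p"
    using oe(1,4)[OF assms(3)] assms by (auto simp: swap_ends_def)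
qed

text \<open>The number of boundary components of the spanning subgraph with chord set
  \<open>B\<close>. For \<open>D = {}\<close> this gives 0, since the bare disc carries no flags;
  this is why \<open>D \<noteq> {}\<close> is assumed below.\<close>

definition n_faces :: "complex set set \<Rightarrow> complex set set \<Rightarrow> nat" where
  "n_faces D B = n_cycles (\<Union>D) (swap_ends D B \<circ> next_pt (\<Union>D))"

text \<open>
  Euler's formula for \<open>e\<close> edges, where \<open>k\<close> counts vertices and boundary components together. The
  existence of such a number is never needed, since only equality of the arguments matters.
\<close>

definition euler_genus :: "nat \<Rightarrow> nat \<Rightarrow> nat" where
  "euler_genus e k = (THE g. 2 - 2 * int g = int k - int e)"

text \<open>Dualizing exchanges \<open>free_side\<close> and \<open>attach\<close> over
  \<open>B\<close>. So the vertices of the dual are the boundary components for \<open>B\<close>,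
  and its boundary components are those for the complement of \<open>B\<close>.\<close>

lemma genus_partial_dual:
  assumes D: "chord_diagram n D" "D \<noteq> {}" and B: "B \<subseteq> D"
  shows "genus (partial_dual (ribbon_graph_of D) ((\<lambda>c. c \<times> UNIV) ` B)) =
    euler_genus n (n_faces D B + n_faces D (D - B))"
proof -
  let ?G = "ribbon_graph_of D" and ?U = "(\<lambda>c. c \<times> (UNIV :: bool set)) ` B"
  let ?H = "partial_dual ?G ?U"
  note P = chord_diagram_ends[OF D(1)]
  have U: "(p, d) \<in> \<Union>?U \<longleftrightarrow> p \<in> \<Union>B" for p d by auto
  have disj: "p \<in> \<Union>(D - B) \<longleftrightarrow> p \<notin> \<Union>B" if "p \<in> \<Union>D" for p
    using D(1) B that unfolding chord_diagram_def by (auto dest: disjointD)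
  have orb: "card (orbits (\<Union>D \<times> UNIV) {h, disc_arc ?H}) = n_faces D B'"
    if "B' \<subseteq> D" "\<And>p d. p \<in> \<Union>D \<Longrightarrow> h (p, d) = (swap_ends D B' p, \<not> d)" for h B'
    unfolding n_faces_def
  proof (rule card_orbits_eq_n_cycles[where m = "prev_pt (\<Union>D)"])
    fix p assume p: "p \<in> \<Union>D"
    note q = P(1,2) p P(3)[OF p]
    show "next_pt (\<Union>D) p \<in> \<Union>D" "prev_pt (\<Union>D) p \<in> \<Union>D"
      using next_pt(1)[OF q] prev_pt(1)[OF q] by blast+
    show "prev_pt (\<Union>D) (next_pt (\<Union>D) p) = p" "next_pt (\<Union>D) (prev_pt (\<Union>D) p) = p"
      by (rule prev_next_pt[OF q] next_prev_pt[OF q])+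
    show "swap_ends D B' p \<in> \<Union>D" "swap_ends D B' (swap_ends D B' p) = p"
      by (rule swap_ends[OF D(1) that(1) p])+
  qed (use that in \<open>simp_all add: partial_dual_def ribbon_graph_of_def\<close>)
  have flags: "flags ?H = \<Union>D \<times> UNIV" and bare: "n_bare ?H = 0"
    using D(2) by (simp_all add: partial_dual_def ribbon_graph_of_def)
  have att: "attach ?H (p, d) = (swap_ends D B p, \<not> d)" for p d
    by (simp del: Union_iff UN_iff add: partial_dual_def U swap_ends_def) (simp add: ribbon_graph_of_def)
  have free: "free_side ?H (p, d) = (swap_ends D (D - B) p, \<not> d)" if "p \<in> \<Union>D" for p d
    using disj[OF that]
    by (simp del: Union_iff UN_iff add: partial_dual_def U swap_ends_def) (simp add: ribbon_graph_of_def)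
  have "n_vertices ?H = n_faces D B" "n_boundary ?H = n_faces D (D - B)"
    unfolding n_vertices_def n_boundary_def flags bare
    using orb[OF B att] orb[OF _ free] by simp_all
  moreover have "card (edges ?H) = n"
  proof -
    have "inj (\<lambda>c :: complex set. c \<times> (UNIV :: bool set))" by (auto simp: inj_def)
    then have "card (edges ?H) = card D"
      unfolding edges_partial_dual edges_ribbon_graph_of[OF D(1)]
      by (intro card_image) (rule inj_on_subset[OF _ subset_UNIV])
    then show ?thesis using D(1) by (simp add: chord_diagram_def)
  qed
  ultimately show ?thesis by (simp add: genus_def euler_genus_def algebra_simps)
qed

lemma chord_pd_genus_poly_eq:
  assumes "chord_diagram n D" "D \<noteq> {}"
  shows "chord_pd_genus_poly D =
    (\<Sum>B\<in>Pow D. monom 1 (euler_genus n (n_faces D B + n_faces D (D - B))))"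
proof -
  let ?f = "\<lambda>c :: complex set. c \<times> (UNIV :: bool set)"
  have "inj ?f" by (auto simp: inj_def)
  then have "bij_betw ?f D (?f ` D)" by (simp add: bij_betw_def inj_on_subset[OF _ subset_UNIV])
  then have "bij_betw (image ?f) (Pow D) (Pow (?f ` D))" by (rule bij_betw_Pow)
  from sum.reindex_bij_betw[OF this, symmetric]
  show ?thesis
    unfolding chord_pd_genus_poly_def pd_genus_poly_def edges_ribbon_graph_of[OF assms(1)]
    by (rule trans) (rule sum.cong[OF refl], simp only: Pow_iff genus_partial_dual[OF assms])
qed


section \<open>Adding a chord\<close>

lemma chord_diagram_insert:
  assumes "chord_diagram n D" "a \<in> circle" "x \<in> circle" "a \<noteq> x" "a \<notin> \<Union>D" "x \<notin> \<Union>D"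
  shows "chord_diagram (Suc n) (insert {a, x} D)"
proof -
  have "{a, x} \<notin> D" using assms(5) by blast
  moreover have "disjoint (insert {a, x} D)"
    using assms by (auto simp: chord_diagram_def disjoint_def)
  ultimately show ?thesis using assms by (auto simp: chord_diagram_def)
qed

lemma swap_ends_insert:
  assumes D: "chord_diagram n D" "a \<in> circle" "x \<in> circle" "a \<noteq> x" "a \<notin> \<Union>D" "x \<notin> \<Union>D"
    and "B \<subseteq> D" and y: "y \<in> insert x (insert a (\<Union>D))"
  shows "swap_ends (insert {a, x} D) B y = swap_ends D B y"
    and "swap_ends (insert {a, x} D) (insert {a, x} B) y = link a x (swap_ends D B) y"
proof -
  note oe = other_end_eqI[OF chord_diagram_insert[OF D]]
  have "other_end (insert {a, x} D) a = x" by (rule oe) auto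
  moreover have "other_end (insert {a, x} D) x = a" by (rule oe) auto
  moreover have "other_end (insert {a, x} D) y = other_end D y" if "y \<in> \<Union>D"
    using other_end(1)[OF D(1) that] that by (intro oe) auto
  moreover have "\<Union>B \<subseteq> \<Union>D" using assms(7) by blast
  ultimately show "swap_ends (insert {a, x} D) B y = swap_ends D B y"
    "swap_ends (insert {a, x} D) (insert {a, x} B) y = link a x (swap_ends D B) y"
    using D y by (auto simp: swap_ends_def link_def)
qed

lemma cyclic_pairing_swap_ends:
  assumes D: "chord_diagram n D" "D \<noteq> {}" "a \<in> circle" "a \<notin> \<Union>D" and "B \<subseteq> D"
  defines "P \<equiv> insert a (\<Union>D)"
  shows "cyclic_pairing P (next_pt P) (swap_ends D B) a" "finite P" "P \<subseteq> circle"
    "\<And>p. p \<in> P \<Longrightarrow> P - {p} \<noteq> {}"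
proof -
  note ends = chord_diagram_ends[OF D(1)]
  show P: "finite P" "P \<subseteq> circle" using ends D by (auto simp: P_def)
  have "\<Union>D \<noteq> {}"
  proof -
    obtain c where "c \<in> D" using D(2) by blast
    then have "c \<in> D" "card c = 2" using D(1) by (auto simp: chord_diagram_def)
    then show ?thesis by (cases "c = {}") auto
  qed
  then show ne: "P - {p} \<noteq> {}" if "p \<in> P" for p
    using ends(3)[of p] D(4) that by (auto simp: P_def)
  have fixed: "swap_ends D B a = a" using D(4) assms(5) by (auto simp: swap_ends_def)
  show "cyclic_pairing P (next_pt P) (swap_ends D B) a"
  proof
    fix y assume y: "y \<in> P"
    show "next_pt P y \<in> P" "next_pt P y \<noteq> y" using next_pt(1)[OF P y ne[OF y]] by auto
    have "swap_ends D B y \<in> P \<and> swap_ends D B (swap_ends D B y) = y"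
    proof (cases "y = a")
      case False
      then have "y \<in> \<Union>D" using y by (simp add: P_def)
      from swap_ends[OF D(1) assms(5) this] show ?thesis unfolding P_def by blast
    qed (simp add: fixed P_def)
    then show "swap_ends D B y \<in> P" "swap_ends D B (swap_ends D B y) = y" by blast+
    fix y' assume y': "y' \<in> P" "next_pt P y = next_pt P y'"
    show "y = y'"
      using prev_next_pt[OF P y ne[OF y]] prev_next_pt[OF P y'(1) ne[OF y'(1)]] y'(2) by metis
  next
    show "a \<in> P" "swap_ends D B a = a" using fixed by (simp_all add: P_def)
  qed
qed

text \<open>Splits the effect of the new chord: a set without it is handled by
  \<open>unlinked\<close>, while a set with it gives the number \<open>cyc l x\<close> of the
  locale.\<close>

lemma n_faces_insert:
  assumes D: "chord_diagram n D" "D \<noteq> {}" "a \<in> circle" "a \<notin> \<Union>D" and B: "B \<subseteq> D"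
  defines "P \<equiv> insert a (\<Union>D)"
  assumes x: "l \<in> P" "x \<notin> P" "x \<in> ccw_arc l (next_pt P l)"
  shows "n_faces (insert {a, x} D) B = n_cycles P (swap_ends D B \<circ> next_pt P)"
    and "n_faces (insert {a, x} D) (insert {a, x} B) =
      n_cycles (insert x P) (link a x (swap_ends D B) \<circ> insert_after l x (next_pt P))"
proof -
  interpret cyclic_pairing P "next_pt P" "swap_ends D B" a
    unfolding P_def by (rule cyclic_pairing_swap_ends[OF D B])
  note P = cyclic_pairing_swap_ends(2-4)[OF D B, folded P_def]
  have "x \<in> circle" using x(3) by (simp add: ccw_arc_def)
  with x(2) D have D': "chord_diagram n D" "a \<in> circle" "x \<in> circle" "a \<noteq> x" "a \<notin> \<Union>D" "x \<notin> \<Union>D"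
    by (auto simp: P_def)
  note sw = swap_ends_insert[OF D' B, folded P_def]
  have U: "\<Union>(insert {a, x} D) = insert x P" by (auto simp: P_def)
  have nxt: "next_pt (insert x P) y = insert_after l x (next_pt P) y"
      and nxt_in: "insert_after l x (next_pt P) y \<in> insert x P"
    if "y \<in> insert x P" for y
    using next_pt_insert[OF P(1,2) x(1) P(3)[OF x(1)] x(2,3) that] c_in x that
    by (auto simp: insert_after_def)
  have "n_faces (insert {a, x} D) B =
      n_cycles (insert x P) (swap_ends D B \<circ> insert_after l x (next_pt P))"
    unfolding n_faces_def U using nxt nxt_in sw(1) by (intro n_cycles_cong) simp
  also have "\<dots> = n_cycles P (swap_ends D B \<circ> next_pt P)"
    using D'(6) B x by (intro unlinked) (auto simp: swap_ends_def)
  finally show "n_faces (insert {a, x} D) B = n_cycles P (swap_ends D B \<circ> next_pt P)" .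
  show "n_faces (insert {a, x} D) (insert {a, x} B) =
      n_cycles (insert x P) (link a x (swap_ends D B) \<circ> insert_after l x (next_pt P))"
    unfolding n_faces_def U using nxt nxt_in sw(2) by (intro n_cycles_cong) simp
qed

text \<open>The genus of the partial dual of \<open>insert {a, x} D\<close> relative to
  \<open>insert {a, x} B\<close>. Only the first cycle number depends on the place of
  \<open>x\<close>.\<close>

definition inserted_genus ::
    "complex set set \<Rightarrow> complex \<Rightarrow> complex \<Rightarrow> complex \<Rightarrow> complex set set \<Rightarrow> nat" where
  "inserted_genus D a l x B = (let P = insert a (\<Union>D) in euler_genus (Suc (card D))
     (n_cycles (insert x P) (link a x (swap_ends D B) \<circ> insert_after l x (next_pt P)) +
      n_cycles P (swap_ends D (D - B) \<circ> next_pt P)))"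

text \<open>Subsets of the new diagram are sorted by whether they contain the new chord. One that
  does not has the same genus as its complement, which does, because the two face counts enter only
  through their sum.\<close>

lemma chord_pd_genus_poly_insert:
  assumes D: "chord_diagram n D" "D \<noteq> {}" "a \<in> circle" "a \<notin> \<Union>D"
  defines "P \<equiv> insert a (\<Union>D)"
  assumes x: "l \<in> P" "x \<notin> P" "x \<in> ccw_arc l (next_pt P l)"
  shows "chord_pd_genus_poly (insert {a, x} D) =
    (\<Sum>B\<in>Pow D. monom 1 (inserted_genus D a l x B) + monom 1 (inserted_genus D a l x (D - B)))"
proof -
  let ?t = "{a, x}"
  let ?D = "insert ?t D"
  let ?g = "\<lambda>B. monom (1 :: int) (euler_genus (Suc n) (n_faces ?D B + n_faces ?D (?D - B)))"
  have t: "?t \<notin> D" using D(4) by blast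
  have fin: "finite D" "card D = n" using D(1) by (simp_all add: chord_diagram_def)
  have "x \<in> circle" using x(3) by (simp add: ccw_arc_def)
  then have D': "chord_diagram (Suc n) ?D"
    using D x(2) by (intro chord_diagram_insert) (auto simp: P_def)
  note faces = n_faces_insert[OF D _ x[unfolded P_def]]
  have "?g (insert ?t B) = monom 1 (inserted_genus D a l x B)" if "B \<subseteq> D" for B
  proof -
    have "?D - insert ?t B = D - B" using t that by blast
    then show ?thesis
      using faces(2)[OF that] faces(1)[of "D - B"] fin(2) by (simp add: inserted_genus_def Let_def)
  qed
  moreover have "?g B = monom 1 (inserted_genus D a l x (D - B))" if "B \<subseteq> D" for B
  proof -
    have "?D - B = insert ?t (D - B)" "D - (D - B) = B" using t that by blast+
    then show ?thesis
      using faces(2)[of "D - B"] faces(1)[OF that] fin(2)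
      by (simp add: inserted_genus_def Let_def add.commute)
  qed
  moreover have "(\<Sum>B\<in>Pow ?D. ?g B) = (\<Sum>B\<in>Pow D. ?g (insert ?t B) + ?g B)"
  proof -
    have "inj_on (insert ?t) (Pow D)"
      using t by (intro inj_onI) (blast dest: insert_ident[THEN iffD1, rotated 2])
    moreover have "Pow D \<inter> insert ?t ` Pow D = {}" using t by blast
    ultimately show ?thesis
      using fin(1) by (simp only: Pow_insert sum.distrib sum.union_disjoint finite_Pow_iff
        finite_imageI sum.reindex comp_def add.commute)
  qed
  ultimately show ?thesis
    unfolding chord_pd_genus_poly_eq[OF D' insert_not_empty] by (simp cong: sum.cong_simp)
qed

section \<open>Pairwise cancellation of the four terms\<close>

theorem mainTheorem1:
  fixes n :: nat and D :: "complex set set" and s :: "complex set"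
    and a b r b_minus b_plus r_minus r_plus :: complex
  assumes "n \<ge> 2"
    and "chord_diagram (n - 1) D"
    and "s \<in> D" and "s = {b, r}"
    and "a \<in> circle" and "a \<notin> \<Union>D"
    and "immediately_before (insert a (\<Union>D)) b b_minus"
    and "immediately_after (insert a (\<Union>D)) b b_plus"
    and "immediately_before (insert a (\<Union>D)) r r_minus"
    and "immediately_after (insert a (\<Union>D)) r r_plus"
  shows "chord_pd_genus_poly (insert {a, b_minus} D)
       - chord_pd_genus_poly (insert {a, b_plus} D)
       + chord_pd_genus_poly (insert {a, r_minus} D)
       - chord_pd_genus_poly (insert {a, r_plus} D) = 0"
proof -
  define P where "P = insert a (\<Union>D)"
  let ?c = "next_pt P"
  have D: "chord_diagram (n - 1) D" "D \<noteq> {}" "a \<in> circle" "a \<notin> \<Union>D"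
    using assms by auto
  note P = cyclic_pairing_swap_ends(2-4)[OF D empty_subsetI, folded P_def]
  have br: "b \<in> \<Union>D" "r \<in> \<Union>D" "{b, r} \<in> D" "{r, b} \<in> D"
    using assms(3,4) by (auto simp: insert_commute)
  have oe: "other_end D b = r" "other_end D r = b" "b \<noteq> r"
    using other_end_eqI[OF D(1)] other_end(2)[OF D(1)] br by metis+
  have bP: "b \<in> P" "r \<in> P" "b \<noteq> a" "r \<noteq> a" using br D(4) by (auto simp: P_def)
  \<comment> \<open>The points \<open>b_minus\<close> and \<open>r_minus\<close> lie in the gaps
    that start at \<open>pb\<close> and \<open>pr\<close>. Either of these may be \<open>a\<close>,
    so predecessors are taken in \<open>P\<close> and not among the ends of
    \<open>D\<close>.\<close>
  define pb pr where "pb = prev_pt P b" and "pr = prev_pt P r"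
  have prev: "pb \<in> P" "?c pb = b" "pr \<in> P" "?c pr = r"
    using prev_pt(1)[OF P(1,2) _ P(3)] next_prev_pt[OF P(1,2) _ P(3)] bP
    unfolding pb_def pr_def by blast+
  have x: "b_minus \<in> ccw_arc pb (?c pb)" "b_plus \<in> ccw_arc b (?c b)"
    "r_minus \<in> ccw_arc pr (?c pr)" "r_plus \<in> ccw_arc r (?c r)"
    using immediately_before_in_ccw_arc[OF P(1,2) _ P(3)]
      immediately_after_in_ccw_arc[OF P(1,2) _ P(3)] bP assms(7-10)
    unfolding prev unfolding pb_def pr_def P_def[symmetric] by blast+
  have xP: "b_minus \<notin> P" "b_plus \<notin> P" "r_minus \<notin> P" "r_plus \<notin> P"
    using assms(7-10) unfolding immediately_before_def immediately_after_def P_def by blast+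
  let ?g = "\<lambda>l x B. monom (1 :: int) (inserted_genus D a l x B)"
  have four: "?g pb b_minus B - ?g b b_plus B + ?g pr r_minus B - ?g r r_plus B = 0"
    if B: "B \<subseteq> D" for B
  proof -
    interpret cyclic_pairing P ?c "swap_ends D B" a
      unfolding P_def by (rule cyclic_pairing_swap_ends[OF D B])
    \<comment> \<open>The cycle number of the complement is the same on both sides, so comparing
      \<open>cyc\<close> suffices.\<close>
    have geq: "?g l x B = ?g l' x' B" if "cyc l x = cyc l' x'" for l x l' x'
      using that by (simp add: inserted_genus_def P_def)
    show ?thesis
    proof (cases "s \<in> B")
      case True
      then have "swap_ends D B b = r" "swap_ends D B r = b"
        using oe assms(4) by (auto simp: swap_ends_def)
      \<comment> \<open>Along the ribbon of \<open>s\<close>, the end before \<open>b\<close> slides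
        to the gap after \<open>r\<close>, and the end before \<open>r\<close> to the gap after
        \<open>b\<close>. Renaming then turns them into \<open>r_plus\<close> and
        \<open>b_plus\<close>, which carry the opposite sign.\<close>
      then have "cyc pb b_minus = cyc r b_minus" "cyc pr r_minus = cyc b r_minus"
        using slide_along_chord[OF xP(1) prev(1,2) bP(2)] slide_along_chord[OF xP(3) prev(3,4) bP(1)]
          oe(3) by auto
      then have "?g pb b_minus B = ?g r r_plus B" "?g pr r_minus B = ?g b b_plus B"
        using rename[OF xP(1,4) bP(2)] rename[OF xP(3,2) bP(1)] by (intro geq; simp)+
      then show ?thesis by simp
    next
      case False
      have "s \<inter> e = {}" if "e \<in> B" for e
        using D(1) assms(3) that B False
        by (intro disjointD[of D]) (auto simp: chord_diagram_def)
      then have "b \<notin> \<Union>B" "r \<notin> \<Union>B" using assms(4) by blast+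
      then have "swap_ends D B b = b" "swap_ends D B r = r" by (simp_all add: swap_ends_def)
      \<comment> \<open>With \<open>s\<close> not selected, each end slides past \<open>b\<close> or
        \<open>r\<close>, so the minus and plus terms at the same end cancel.\<close>
      then have "cyc pb b_minus = cyc b b_minus" "cyc pr r_minus = cyc r r_minus"
        using slide_past_end[OF xP(1) prev(1,2)] slide_past_end[OF xP(3) prev(3,4)] bP by auto
      then have "?g pb b_minus B = ?g b b_plus B" "?g pr r_minus B = ?g r r_plus B"
        using rename[OF xP(1,2) bP(1)] rename[OF xP(3,4) bP(2)] by (intro geq; simp)+
      then show ?thesis by simp
    qed
  qed
  note poly = chord_pd_genus_poly_insert[OF D, folded P_def]
  \<comment> \<open>The summands are regrouped so that \<open>four\<close> applies once to
    \<open>B\<close> and once to \<open>D - B\<close>.\<close>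
  have "chord_pd_genus_poly (insert {a, b_minus} D) - chord_pd_genus_poly (insert {a, b_plus} D)
       + chord_pd_genus_poly (insert {a, r_minus} D) - chord_pd_genus_poly (insert {a, r_plus} D) =
    (\<Sum>B\<in>Pow D.
      (?g pb b_minus B - ?g b b_plus B + ?g pr r_minus B - ?g r r_plus B) +
      (?g pb b_minus (D - B) - ?g b b_plus (D - B) + ?g pr r_minus (D - B) - ?g r r_plus (D - B)))"
    unfolding poly[OF prev(1) xP(1) x(1)] poly[OF bP(1) xP(2) x(2)] poly[OF prev(3) xP(3) x(3)]
      poly[OF bP(2) xP(4) x(4)] sum_subtractf[symmetric] sum.distrib[symmetric]
    by (intro sum.cong refl) (simp add: algebra_simps)
  also have "\<dots> = 0" using four by (intro sum.neutral) auto
  finally show ?thesis .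
qed

end
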